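(* Let $d$ be a positive integer. The complete theory of the structure $(\mathbb{Z},+,d^{\mathbb{N}},\times\restriction_{d^{\mathbb{N}}})$ is NIP, where $d^{\mathbb{N}}=\{d^k:k\in\mathbb{N}\}$ is a unary predicate and $\times\restriction_{d^{\mathbb{N}}}=\{(a,b,c)\in(d^{\mathbb{N}})^3: ab=c\}$ is a ternary predicate.
   Context: $\mathbb{N}=\{0,1,2,\ldots\}$. *)

theory Defs imports Main begin

section \<open>First-order logic with equality\<close>

record ('f, 'r) signature =
  fun_arity :: "'f \<Rightarrow> nat"
  rel_arity :: "'r \<Rightarrow> nat"

datatype 'f trm = Var nat | App 'f "'f trm list"

datatype ('f, 'r) fm =
    Equal "'f trm" "'f trm"
  | Rel 'r "'f trm list"
  | Neg "('f, 'r) fm"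
  | Conj "('f, 'r) fm" "('f, 'r) fm"
  | Exists nat "('f, 'r) fm"

text \<open>
  The syntax trees above do not enforce arities; the formulas of a signature are those
  satisfying the following predicate.
\<close>

fun wf_trm :: "('f, 'r) signature \<Rightarrow> 'f trm \<Rightarrow> bool" where
  "wf_trm L (Var v) \<longleftrightarrow> True"
| "wf_trm L (App f ts) \<longleftrightarrow> length ts = fun_arity L f \<and> (\<forall>t\<in>set ts. wf_trm L t)"

fun wf_fm :: "('f, 'r) signature \<Rightarrow> ('f, 'r) fm \<Rightarrow> bool" where
  "wf_fm L (Equal s t) \<longleftrightarrow> wf_trm L s \<and> wf_trm L t"
| "wf_fm L (Rel r ts) \<longleftrightarrow> length ts = rel_arity L r \<and> (\<forall>t\<in>set ts. wf_trm L t)"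
| "wf_fm L (Neg \<phi>) \<longleftrightarrow> wf_fm L \<phi>"
| "wf_fm L (Conj \<phi> \<psi>) \<longleftrightarrow> wf_fm L \<phi> \<and> wf_fm L \<psi>"
| "wf_fm L (Exists v \<phi>) \<longleftrightarrow> wf_fm L \<phi>"

fun fv_trm :: "'f trm \<Rightarrow> nat set" where
  "fv_trm (Var v) = {v}"
| "fv_trm (App f ts) = (\<Union>t\<in>set ts. fv_trm t)"

fun fv_fm :: "('f, 'r) fm \<Rightarrow> nat set" where
  "fv_fm (Equal s t) = fv_trm s \<union> fv_trm t"
| "fv_fm (Rel r ts) = (\<Union>t\<in>set ts. fv_trm t)"
| "fv_fm (Neg \<phi>) = fv_fm \<phi>"
| "fv_fm (Conj \<phi> \<psi>) = fv_fm \<phi> \<union> fv_fm \<psi>"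
| "fv_fm (Exists v \<phi>) = fv_fm \<phi> - {v}"

definition sentences :: "('f, 'r) signature \<Rightarrow> ('f, 'r) fm set" where
  "sentences L = {\<phi>. wf_fm L \<phi> \<and> fv_fm \<phi> = {}}"

text \<open>
  The universe of a structure is the whole type \<open>'m\<close>.  The values of an interpretation on
  argument lists of the wrong length are irrelevant, since no well-formed formula refers to
  them.
\<close>

record ('f, 'r, 'm) struct =
  fun_int :: "'f \<Rightarrow> 'm list \<Rightarrow> 'm"
  rel_int :: "'r \<Rightarrow> 'm list \<Rightarrow> bool"

fun eval_trm :: "('f, 'r, 'm) struct \<Rightarrow> (nat \<Rightarrow> 'm) \<Rightarrow> 'f trm \<Rightarrow> 'm" where
  "eval_trm M e (Var v) = e v"
| "eval_trm M e (App f ts) = fun_int M f (map (eval_trm M e) ts)"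

fun sat :: "('f, 'r, 'm) struct \<Rightarrow> (nat \<Rightarrow> 'm) \<Rightarrow> ('f, 'r) fm \<Rightarrow> bool" where
  "sat M e (Equal s t) \<longleftrightarrow> eval_trm M e s = eval_trm M e t"
| "sat M e (Rel r ts) \<longleftrightarrow> rel_int M r (map (eval_trm M e) ts)"
| "sat M e (Neg \<phi>) \<longleftrightarrow> \<not> sat M e \<phi>"
| "sat M e (Conj \<phi> \<psi>) \<longleftrightarrow> sat M e \<phi> \<and> sat M e \<psi>"
| "sat M e (Exists v \<phi>) \<longleftrightarrow> (\<exists>m. sat M (e(v := m)) \<phi>)"

definition models :: "('f, 'r, 'm) struct \<Rightarrow> ('f, 'r) fm set \<Rightarrow> bool" where
  "models M T \<longleftrightarrow> (\<forall>\<phi>\<in>T. \<forall>e. sat M e \<phi>)"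

definition complete_theory ::
    "('f, 'r) signature \<Rightarrow> ('f, 'r, 'm) struct \<Rightarrow> ('f, 'r) fm set" where
  "complete_theory L M = {\<phi> \<in> sentences L. \<forall>e. sat M e \<phi>}"

section \<open>The independence property\<close>

text \<open>
  A partitioned formula \<open>\<phi>(x; y)\<close> is a formula together with the set \<open>X\<close> of the variables in
  the tuple \<open>x\<close>; the tuple \<open>y\<close> consists of the free variables outside \<open>X\<close>.  Tuples are given
  as assignments, of which only the values on \<open>X\<close> (for \<open>x\<close>) or off \<open>X\<close> (for \<open>y\<close>) are used.
  The formula has the independence property in \<open>M\<close> if for every \<open>n\<close> there are tuples \<open>a\<^sub>i\<close>
  (\<open>i < n\<close>) and \<open>b\<^sub>I\<close> (\<open>I \<subseteq> {..<n}\<close>) such that \<open>\<phi>(a\<^sub>i; b\<^sub>I)\<close> holds iff \<open>i \<in> I\<close>.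
\<close>

definition has_IP :: "('f, 'r, 'm) struct \<Rightarrow> ('f, 'r) fm \<Rightarrow> nat set \<Rightarrow> bool" where
  "has_IP M \<phi> X \<longleftrightarrow>
     (\<forall>n. \<exists>(a :: nat \<Rightarrow> nat \<Rightarrow> 'm) (b :: nat set \<Rightarrow> nat \<Rightarrow> 'm).
        \<forall>i<n. \<forall>I\<subseteq>{..<n}. sat M (override_on (b I) (a i) X) \<phi> \<longleftrightarrow> i \<in> I)"

text \<open>
  A theory is NIP if no formula has the independence property in any of its models.  A
  definition in HOL cannot quantify over all types, so the type of the universes of the
  models is a parameter; that a theory is NIP is to be stated for an arbitrary type \<open>'m\<close>.
\<close>

definition NIP :: "'m itself \<Rightarrow> ('f, 'r) signature \<Rightarrow> ('f, 'r) fm set \<Rightarrow> bool" where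
  "NIP _ L T \<longleftrightarrow>
     (\<forall>M :: ('f, 'r, 'm) struct. models M T \<longrightarrow>
        (\<forall>\<phi> X. wf_fm L \<phi> \<longrightarrow> \<not> has_IP M \<phi> X))"

section \<open>The integers with addition and multiplication restricted to powers\<close>

datatype pow_fun = Plus

datatype pow_rel = Pow | PowMult

definition pow_sig :: "(pow_fun, pow_rel) signature" where
  "pow_sig = \<lparr>
     fun_arity = (\<lambda>f. case f of Plus \<Rightarrow> 2),
     rel_arity = (\<lambda>r. case r of Pow \<Rightarrow> 1 | PowMult \<Rightarrow> 3)\<rparr>"

definition powers :: "nat \<Rightarrow> int set" where
  "powers d = {int d ^ k | k :: nat. True}"

definition int_pow_struct :: "nat \<Rightarrow> (pow_fun, pow_rel, int) struct" where
  "int_pow_struct d = \<lparr>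
     fun_int = (\<lambda>f xs. case f of Plus \<Rightarrow> xs ! 0 + xs ! 1),
     rel_int = (\<lambda>r xs. case r of
         Pow \<Rightarrow> xs ! 0 \<in> powers d
       | PowMult \<Rightarrow> xs ! 0 \<in> powers d \<and> xs ! 1 \<in> powers d \<and> xs ! 2 \<in> powers d
                    \<and> xs ! 0 * xs ! 1 = xs ! 2)\<rparr>"

end

theory Submission
  imports Defs "HOL-Library.FuncSet" "HOL-Library.Nat_Bijection"
begin

text \<open>
  The independence property of a formula is expressed by sentences, so it suffices to work in
  \<open>\<int>\<close>.  Existential quantifiers over \<open>\<int>\<close> can be traded for quantifiers over exponents: for a
  witness \<open>x\<close> either \<open>k x + t + \<Sum> c\<^sub>j d^n\<^sub>j = 0\<close> for one of finitely many shapes of equations with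
  \<open>k \<noteq> 0\<close>, and \<open>x\<close> can be substituted, or all such equations fail, and then only the residue of \<open>x\<close>
  matters, because integers avoiding all these equations exist in every residue class.

  The resulting formulas, whose quantifiers range over exponents only, are handled by counting.
  If some \<open>t(a\<^sub>i) + t(b)\<close> is a sum of powers of the given shape, then \<open>t(b)\<close> is, up to the finitely many
  choices of \<open>i\<close>, given by a tuple of exponents, and all other \<open>t(a\<^sub>j) + t(b)\<close> either are given by
  exponents as well or are not such sums for reasons independent of \<open>b\<close>.  This leaves a
  Presburger formula in the exponents, and by quantifier elimination it cuts out polynomially many
  subsets of \<open>n\<close> parameters, less than \<open>2^n\<close>.
\<close>

section \<open>Integer combinations and Presburger predicates\<close>

text \<open>For \<open>d \<ge> 2\<close>, avoiding integers exist because sums of powers are sparse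
  modulo \<open>q = d^\<kappa> - 1\<close>: the powers of \<open>d\<close> take at most
  \<open>\<kappa>\<close> values there, so a combination of \<open>m\<close> powers takes at most
  \<open>\<kappa>^m\<close>, while \<open>q\<close> grows exponentially in \<open>\<kappa>\<close>.
  The obstacle that remains is that removing an integer quantifier creates exponent quantifiers,
  whose atoms mix integer parameters with exponents and so are not Presburger conditions. These
  quantifiers are kept until the parameters themselves have been replaced by exponents; each atom is
  then false or a vanishing sum of powers. The latter is a Presburger condition, because the term of
  largest exponent can be cancelled only if another exponent is close to it. All classes of
  predicates are described semantically, by closure rules on functions of assignments, so that no
  intermediate formula syntax appears.\<close>

inductive zspan :: "('a \<Rightarrow> int) set \<Rightarrow> ('a \<Rightarrow> int) \<Rightarrow> bool" for B where
  base: "b \<in> B \<Longrightarrow> zspan B b"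
| add: "zspan B s \<Longrightarrow> zspan B t \<Longrightarrow> zspan B (\<lambda>x. s x + t x)"
| scale: "zspan B t \<Longrightarrow> zspan B (\<lambda>x. c * t x)"

lemma zspan_zero: "zspan B t \<Longrightarrow> zspan B (\<lambda>x. 0)"
  using zspan.scale[of B t 0] by simp

lemma zspan_uminus: "zspan B t \<Longrightarrow> zspan B (\<lambda>x. - t x)"
  using zspan.scale[of B t "-1"] by simp

lemma zspan_diff: "zspan B s \<Longrightarrow> zspan B t \<Longrightarrow> zspan B (\<lambda>x. s x - t x)"
  using zspan.add[OF _ zspan_uminus] by fastforce

lemma zspan_comp:
  assumes "zspan B t" "\<And>b. b \<in> B \<Longrightarrow> (\<lambda>x. b (r x)) \<in> B'"
  shows "zspan B' (\<lambda>x. t (r x))"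
  using assms(1) by induction (auto intro: zspan.intros assms(2))

lemma zspan_range_sum:
  assumes "zspan (range b) t"
  obtains c and m :: nat where "t = (\<lambda>x. \<Sum>j<m. c j * b j x)"
proof -
  have "\<exists>c m. t = (\<lambda>x. \<Sum>j<m. c j * b j x)"
    using assms
  proof induction
    case (base s)
    then obtain i where i: "s = b i" by auto
    have "s = (\<lambda>x. \<Sum>j<Suc i. of_bool (j = i) * b j x)"
      by (simp add: i fun_eq_iff)
    then show ?case by (intro exI)
  next
    case (add s t)
    then obtain c m c' m' where
      s: "s = (\<lambda>x. \<Sum>j<m. c j * b j x)" and t: "t = (\<lambda>x. \<Sum>j<m'. c' j * b j x)"
      by blast
    have pad: "(\<Sum>j<k. u j * b j x) = (\<Sum>j<max m m'. (if j < k then u j else 0) * b j x)"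
      if "k \<le> max m m'" for k u x
      by (rule sum.mono_neutral_cong_left) (use that in auto)
    have "(\<lambda>x. s x + t x) = (\<lambda>x. \<Sum>j<max m m'.
        ((if j < m then c j else 0) + (if j < m' then c' j else 0)) * b j x)"
      by (simp add: s t pad[of m] pad[of m'] distrib_right sum.distrib)
    then show ?case by (intro exI)
  next
    case (scale t a)
    then obtain c m where t: "t = (\<lambda>x. \<Sum>j<m. c j * b j x)" by blast
    have "(\<lambda>x. a * t x) = (\<lambda>x. \<Sum>j<m. (a * c j) * b j x)"
      by (simp add: t sum_distrib_left mult.assoc)
    then show ?case by (intro exI)
  qed
  with that show thesis by blast
qed

text \<open>Terms of the signature, Presburger terms and sums of powers are integer spans that
  differ only in their generators. The signature has no constant symbols, so the generator 1 occurs
  for the affine forms alone.\<close>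

abbreviation lin :: "((nat \<Rightarrow> int) \<Rightarrow> int) \<Rightarrow> bool" where
  "lin \<equiv> zspan (range (\<lambda>i e. e i))"

abbreviation aff :: "((nat \<Rightarrow> nat) \<Rightarrow> int) \<Rightarrow> bool" where
  "aff \<equiv> zspan (insert (\<lambda>f. 1) (range (\<lambda>i f. int (f i))))"

abbreviation expsum :: "nat \<Rightarrow> ((nat \<Rightarrow> nat) \<Rightarrow> int) \<Rightarrow> bool" where
  "expsum d \<equiv> zspan (range (\<lambda>i f. int d ^ f i))"

text \<open>Like \<open>aff_add\<close>, this serves to separate the contributions of
  \<open>a\<close> and \<open>b\<close> in an independence pattern.\<close>

lemma lin_add: "lin t \<Longrightarrow> t (\<lambda>i. e i + e' i) = t e + t e'"
  by (induction rule: zspan.induct) (auto simp: algebra_simps)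

lemma lin_split: "lin t \<Longrightarrow> \<exists>k t'. lin t' \<and> (\<forall>e x. t (e(v := x)) = k * x + t' e)"
proof (induction rule: zspan.induct)
  case (base b)
  then obtain i where i: "b = (\<lambda>e. e i)" by auto
  show ?case
  proof (cases "i = v")
    case True
    have "lin (\<lambda>e. 0)" by (rule zspan_zero[OF zspan.base]) auto
    with True show ?thesis
      by (intro exI[of _ 1] exI[of _ "\<lambda>e. 0"]) (auto simp: i)
  next
    case False
    with base show ?thesis
      by (intro exI[of _ 0] exI[of _ b]) (auto simp: i intro: zspan.base)
  qed
next
  case (add s t)
  then obtain k s' l t' where "lin s'" "lin t'"
    "\<forall>e x. s (e(v := x)) = k * x + s' e" "\<forall>e x. t (e(v := x)) = l * x + t' e"
    by blast
  then show ?case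
    by (intro exI[of _ "k + l"] exI[of _ "\<lambda>e. s' e + t' e"])
       (auto intro: zspan.add simp: distrib_right simp del: fun_upd_apply)
next
  case (scale t c)
  then obtain l t' where "lin t'" "\<forall>e x. t (e(v := x)) = l * x + t' e"
    by blast
  then show ?case
    by (intro exI[of _ "c * l"] exI[of _ "\<lambda>e. c * t' e"])
       (auto intro: zspan.scale simp: distrib_left simp del: fun_upd_apply)
qed

lemma aff_const: "aff (\<lambda>f. c)"
proof -
  have "aff (\<lambda>f. c * 1)" by (intro zspan.scale zspan.base) simp
  then show ?thesis by simp
qed

lemma aff_var: "aff (\<lambda>f. int (f i))"
  by (auto intro: zspan.base)

lemma aff_add: "aff t \<Longrightarrow> t (\<lambda>i. f i + f' i) = t f + t f' - t (\<lambda>i. 0)"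
proof (induction rule: zspan.induct)
  case (scale t c)
  then show ?case by (metis distrib_left right_diff_distrib)
qed auto

lemma aff_comp: "aff t \<Longrightarrow> aff (\<lambda>f. t (\<lambda>i. f (r i)))"
  by (erule zspan_comp) auto

lemma aff_split: "aff t \<Longrightarrow> \<exists>k t'. aff t' \<and> (\<forall>f n. t (f(v := n)) = k * int n + t' f)"
proof (induction rule: zspan.induct)
  case (base b)
  then have "b = (\<lambda>f. 1) \<or> (\<exists>i. b = (\<lambda>f. int (f i)))" by auto
  then show ?case
  proof (elim disjE exE)
    assume "b = (\<lambda>f. 1)"
    then show ?thesis
      by (intro exI[of _ 0] exI[of _ "\<lambda>f. 1"]) (simp add: aff_const)
  next
    fix i assume i: "b = (\<lambda>f. int (f i))"
    show ?thesis
    proof (cases "i = v")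
      case True
      with i show ?thesis
        by (intro exI[of _ 1] exI[of _ "\<lambda>f. 0"]) (simp add: aff_const)
    next
      case False
      with i show ?thesis
        by (intro exI[of _ 0] exI[of _ b]) (simp add: aff_var)
    qed
  qed
next
  case (add s t)
  then obtain k s' l t' where "aff s'" "aff t'"
    "\<forall>e x. s (e(v := x)) = k * int x + s' e" "\<forall>e x. t (e(v := x)) = l * int x + t' e"
    by blast
  then show ?case
    by (intro exI[of _ "k + l"] exI[of _ "\<lambda>e. s' e + t' e"])
       (auto intro: zspan.add simp: distrib_right simp del: fun_upd_apply)
next
  case (scale t c)
  then obtain l t' where "aff t'" "\<forall>e x. t (e(v := x)) = l * int x + t' e"
    by blast
  then show ?case
    by (intro exI[of _ "c * l"] exI[of _ "\<lambda>e. c * t' e"])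
       (auto intro: zspan.scale simp: distrib_left simp del: fun_upd_apply)
qed

lemma expsum_comp: "expsum d g \<Longrightarrow> expsum d (\<lambda>f. g (\<lambda>i. f (r i)))"
  by (erule zspan_comp) auto

text \<open>Hence the solvability of an equation in exponents can be expressed with finitely many
  exponent quantifiers.\<close>

lemma expsum_finite_support:
  assumes "expsum d g"
  shows "\<exists>m. \<forall>f f'. (\<forall>i<m. f i = f' i) \<longrightarrow> g f = g f'"
proof -
  obtain c m where "g = (\<lambda>f. \<Sum>j<m. c j * int d ^ f j)"
    using zspan_range_sum[OF assms] by metis
  then show ?thesis by (intro exI[of _ m]) auto
qed

text \<open>
  Presburger definability without syntax: a predicate is definable iff it is determined by the
  signs and the residues of finitely many affine forms.
\<close>

definition agree ::
    "((nat \<Rightarrow> nat) \<Rightarrow> int) set \<Rightarrow> int \<Rightarrow> (nat \<Rightarrow> nat) \<Rightarrow> (nat \<Rightarrow> nat) \<Rightarrow> bool" where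
  "agree T N f f' \<longleftrightarrow> (\<forall>t\<in>T. sgn (t f) = sgn (t f') \<and> t f mod N = t f' mod N)"

definition pres :: "((nat \<Rightarrow> nat) \<Rightarrow> bool) \<Rightarrow> bool" where
  "pres P \<longleftrightarrow> (\<exists>T N. finite T \<and> (\<forall>t\<in>T. aff t) \<and> N > 0 \<and>
     (\<forall>f f'. agree T N f f' \<longrightarrow> P f = P f'))"

lemma agree_sym: "agree T N f f' \<Longrightarrow> agree T N f' f"
  by (simp add: agree_def)

lemma agree_mono:
  assumes "agree T' N' f f'" "T \<subseteq> T'" "N dvd N'"
  shows "agree T N f f'"
  unfolding agree_def
proof safe
  fix t assume "t \<in> T"
  then have t: "t \<in> T'" using assms(2) by blast
  then show "sgn (t f) = sgn (t f')" using assms(1) by (simp add: agree_def)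
  have "t f mod N' = t f' mod N'" using t assms(1) by (simp add: agree_def)
  then show "t f mod N = t f' mod N" using assms(3) by (metis mod_mod_cancel)
qed

lemma pres_const: "pres (\<lambda>f. b)"
  unfolding pres_def by (intro exI[of _ "{}"] exI[of _ 1]) auto

lemma pres_not: "pres P \<Longrightarrow> pres (\<lambda>f. \<not> P f)"
  by (simp add: pres_def)

text \<open>The counting argument needs one set of affine forms and one modulus that serve all
  presentations at once. The product of two moduli refines both.\<close>

lemma pres_family:
  assumes "finite S" "\<And>P. P \<in> S \<Longrightarrow> pres P"
  shows "\<exists>T N. finite T \<and> (\<forall>t\<in>T. aff t) \<and> N > 0 \<and>
    (\<forall>P\<in>S. \<forall>f f'. agree T N f f' \<longrightarrow> P f = P f')"
  using assms
proof (induction S)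
  case empty
  show ?case by (intro exI[of _ "{}"] exI[of _ 1]) auto
next
  case (insert P S)
  then obtain T N where 1: "finite T" "\<forall>t\<in>T. aff t" "N > 0"
    "\<forall>P\<in>S. \<forall>f f'. agree T N f f' \<longrightarrow> P f = P f'" by auto
  from insert.prems have "pres P" by simp
  then obtain T' N' where 2: "finite T'" "\<forall>t\<in>T'. aff t" "N' > 0"
    "\<forall>f f'. agree T' N' f f' \<longrightarrow> P f = P f'" unfolding pres_def by (elim exE conjE)
  have "R f = R f'" if ag: "agree (T \<union> T') (N * N') f f'" and R: "R \<in> insert P S" for R f f'
  proof -
    have "agree T N f f'" "agree T' N' f f'" using agree_mono[OF ag] by auto
    then show ?thesis using 1(4) 2(4) R by (metis insert_iff)
  qed
  then show ?case using 1(1-3) 2(1-3)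
    by (intro exI[of _ "T \<union> T'"] exI[of _ "N * N'"] conjI ballI allI impI) auto
qed

lemma pres_conj:
  assumes "pres P" "pres Q"
  shows "pres (\<lambda>f. P f \<and> Q f)"
proof -
  have "\<exists>T N. finite T \<and> (\<forall>t\<in>T. aff t) \<and> N > 0 \<and>
    (\<forall>R\<in>{P, Q}. \<forall>f f'. agree T N f f' \<longrightarrow> R f = R f')"
    using assms by (intro pres_family) auto
  then obtain T N where T: "finite T" "\<forall>t\<in>T. aff t" "N > 0"
    "\<forall>R\<in>{P, Q}. \<forall>f f'. agree T N f f' \<longrightarrow> R f = R f'"
    by (elim exE conjE)
  from T(4) have "\<forall>f f'. agree T N f f' \<longrightarrow> (P f \<and> Q f) = (P f' \<and> Q f')" by simp
  with T(1-3) show ?thesis unfolding pres_def by (intro exI conjI)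
qed

lemma pres_disj: "pres P \<Longrightarrow> pres Q \<Longrightarrow> pres (\<lambda>f. P f \<or> Q f)"
  using pres_not[OF pres_conj[OF pres_not pres_not], of P Q] by simp

lemma pres_bex: "finite S \<Longrightarrow> (\<And>x. x \<in> S \<Longrightarrow> pres (P x)) \<Longrightarrow> pres (\<lambda>f. \<exists>x\<in>S. P x f)"
proof (induction S rule: finite_induct)
  case empty
  show ?case by (simp add: pres_const)
next
  case (insert x S)
  then have "pres (\<lambda>f. P x f \<or> (\<exists>x\<in>S. P x f))" by (intro pres_disj) auto
  then show ?case by simp
qed

lemma pres_comp:
  assumes "pres P"
  shows "pres (\<lambda>f. P (\<lambda>i. f (r i)))"
proof -
  obtain T N where T: "finite T" "\<forall>t\<in>T. aff t" "N > 0"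
    "\<forall>f f'. agree T N f f' \<longrightarrow> P f = P f'" using assms unfolding pres_def by (elim exE conjE)
  have "agree T N (\<lambda>i. f (r i)) (\<lambda>i. f' (r i))"
    if "agree ((\<lambda>t f. t (\<lambda>i. f (r i))) ` T) N f f'" for f f'
    using that by (simp add: agree_def)
  moreover have "\<forall>t\<in>(\<lambda>t f. t (\<lambda>i. f (r i))) ` T. aff t"
    using T(2) aff_comp by blast
  ultimately show ?thesis unfolding pres_def using T
    by (intro exI[of _ "(\<lambda>t f. t (\<lambda>i. f (r i))) ` T"] exI[of _ N]) simp
qed

lemma pres_eq0: "aff t \<Longrightarrow> pres (\<lambda>f. t f = 0)"
  unfolding pres_def agree_def
proof (intro exI[of _ "{t}"] exI[of _ 1] conjI allI impI)
  fix f f' assume "\<forall>t\<in>{t}. sgn (t f) = sgn (t f') \<and> t f mod 1 = t f' mod 1"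
  then show "(t f = 0) = (t f' = 0)" by (auto simp: sgn_if split: if_splits)
qed auto

text \<open>This moves a witness down to a bounded distance above a lower bound. A witness strictly
  above the bound must stay strictly above it, so for \<open>y > 0\<close> the remainder is taken
  from \<open>1\<close> to \<open>D\<close> instead of \<open>0\<close> to
  \<open>D - 1\<close>.\<close>

lemma bounded_remainder:
  fixes y D :: int
  assumes "y \<ge> 0" "D > 0"
  obtains \<delta> where "0 \<le> \<delta>" "\<delta> \<le> D" "\<delta> \<le> y" "\<delta> = 0 \<Longrightarrow> y = 0" "D dvd y - \<delta>"
proof (cases "y = 0")
  case True
  with assms show ?thesis by (intro that[of 0]) auto
next
  case False
  have "y - ((y - 1) mod D + 1) = (y - 1) div D * D"
    using div_mult_mod_eq[of "y - 1" D] by linarith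
  moreover have "(y - 1) mod D \<le> y - 1" 
    using assms False by (intro zmod_le_nonneg_dividend) auto
  moreover have "0 \<le> (y - 1) mod D" "(y - 1) mod D < D" using assms by auto
  ultimately show ?thesis
    by (intro that[of "(y - 1) mod D + 1"]) (linarith | simp)+
qed

text \<open>
  As in Cooper's algorithm, a witness can be moved to a bounded distance above the largest of
  the relevant affine forms below it.  Clearing the coefficients of \<open>n\<close> turns these forms into
  bounds \<open>w\<close> on \<open>K n\<close>; the bound 0 is added since \<open>n\<close> is a natural number.
\<close>

lemma pres_ex:
  assumes "pres P"
  shows "pres (\<lambda>f. \<exists>n. P (f(v := n)))"
proof -
  obtain T N where T: "finite T" "\<forall>t\<in>T. aff t" "N > 0"
    "\<forall>f f'. agree T N f f' \<longrightarrow> P f = P f'" using assms unfolding pres_def by (elim exE conjE)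
  have "\<forall>t\<in>T. \<exists>k u. aff u \<and> (\<forall>f n. t (f(v := n)) = k * int n + u f)"
    using T(2) aff_split by blast
  then obtain k u where u: "\<And>t. t \<in> T \<Longrightarrow> aff (u t)"
    and ku: "\<And>t f n. t \<in> T \<Longrightarrow> t (f(v := n)) = k t * int n + u t f"
    by metis
  define T1 where "T1 = {t \<in> T. k t \<noteq> 0}"
  define K where "K = (\<Prod>t\<in>T1. \<bar>k t\<bar>)"
  have K: "K > 0" unfolding K_def by (rule prod_pos) (auto simp: T1_def)
  have kK: "k t dvd K" if "t \<in> T1" for t
  proof -
    have "finite T1" using T(1) by (simp add: T1_def)
    then have "\<bar>k t\<bar> dvd K" unfolding K_def using that by (rule dvd_prodI)
    then show ?thesis by simp
  qed
  define w where "w t f = - (K div k t) * u t f" for t f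
  have kw: "K * t (f(v := n)) = k t * (K * int n - w t f)" if "t \<in> T1" for t f n
  proof -
    have "k t * (K div k t) = K" using kK[OF that] by simp
    then have "k t * w t f = - K * u t f" unfolding w_def by simp
    moreover have "t (f(v := n)) = k t * int n + u t f" using that ku T1_def by auto
    ultimately show ?thesis by (simp add: algebra_simps)
  qed
  define W where "W = insert (\<lambda>f. 0) (w ` T1)"
  \<comment> \<open>The factor \<open>K\<close> makes the moved value a multiple of \<open>K\<close>
    again, and the factor \<open>N\<close> keeps the residue of the witness modulo
    \<open>N\<close>.\<close>
  define D where "D = K * N"
  have D: "D > 0" using K T(3) by (simp add: D_def)
  have affw: "aff (w t)" if "t \<in> T1" for t
    using u that unfolding w_def[abs_def] T1_def by (intro zspan.scale) simp
  have W: "finite W" "\<And>w. w \<in> W \<Longrightarrow> aff w"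
    using T(1) affw aff_const[of 0] by (auto simp: W_def T1_def)
  \<comment> \<open>The differences compare a moved witness with every bound, the bounds themselves
    are listed for their residues, and \<open>u\<close> covers the forms in which \<open>n\<close>
    does not occur as well as the residues of the others.\<close>
  define T' where "T' = (\<lambda>(w, w', \<delta>) f. w f + \<delta> - w' f) ` (W \<times> W \<times> {0..D}) \<union> W \<union> u ` T"
  have T': "finite T'" "\<forall>t\<in>T'. aff t"
  proof -
    show "finite T'" using W(1) T(1) by (simp add: T'_def)
    have "aff (\<lambda>f. w f + \<delta> - w' f)" if "w \<in> W" "w' \<in> W" for w w' \<delta>
      using W(2)[OF that(1)] W(2)[OF that(2)] aff_const by (intro zspan_diff zspan.add)
    then show "\<forall>t\<in>T'. aff t" using W(2) u by (auto simp: T'_def)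
  qed
  have step: "\<exists>n'. P (f'(v := n'))" if ag: "agree T' D f f'" and P: "P (f(v := n))" for f f' n
  proof -
    define M where "M = Max ((\<lambda>w. w f) ` {w \<in> W. w f \<le> K * int n})"
    have "(\<lambda>f. 0) \<in> {w \<in> W. w f \<le> K * int n}" using K by (auto simp: W_def)
    then have "M \<in> (\<lambda>w. w f) ` {w \<in> W. w f \<le> K * int n}"
      unfolding M_def using W(1) by (intro Max_in) auto
    then obtain z where z: "z \<in> W" "z f \<le> K * int n" "z f = M" by auto
    have max: "w f \<le> z f" if "w \<in> W" "w f \<le> K * int n" for w
      unfolding z(3) M_def using that W(1) by (intro Max_ge) auto
    obtain \<delta> where \<delta>: "0 \<le> \<delta>" "\<delta> \<le> D" "\<delta> \<le> K * int n - z f"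
      "\<delta> = 0 \<Longrightarrow> K * int n - z f = 0" "D dvd K * int n - z f - \<delta>"
      using bounded_remainder[of "K * int n - z f" D] z(2) D by auto
    have sg: "sgn (K * int n - w f) = sgn (z f' + \<delta> - w f')" if w: "w \<in> W" for w
    proof -
      \<comment> \<open>A bound not above \<open>K * int n\<close> is at most \<open>z f\<close> by
        maximality; one above it also exceeds \<open>z f + \<delta>\<close>. Equality is preserved
        since \<open>\<delta> = 0\<close> only if \<open>z f\<close> equals
        \<open>K * int n\<close>.\<close>
      have "sgn (K * int n - w f) = sgn (z f + \<delta> - w f)"
        using max[OF w] \<delta>(1,3,4) by (cases "w f \<le> K * int n") (auto simp: sgn_if)
      moreover have "(\<lambda>f. z f + \<delta> - w f) \<in> T'"
        unfolding T'_def using z w \<delta> by (intro UnI1 image_eqI[of _ _ "(z, w, \<delta>)"]) auto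
      ultimately show ?thesis using ag by (auto simp: agree_def)
    qed
    have "z \<in> T'" using z by (simp add: T'_def)
    then have "z f mod D = z f' mod D" using ag by (simp add: agree_def)
    then have "D dvd z f - z f'" by (simp add: mod_eq_dvd_iff)
    with \<delta>(5) have "D dvd (K * int n - z f - \<delta>) + (z f - z f')" by (rule dvd_add)
    then have Dd: "D dvd K * int n - (z f' + \<delta>)" by (simp add: algebra_simps)
    then have "K dvd K * int n - (z f' + \<delta>)" unfolding D_def by (rule dvd_mult_left)
    then have "K dvd K * int n - (K * int n - (z f' + \<delta>))" by (rule dvd_diff[OF dvd_triv_left])
    moreover have "K * int n - (K * int n - (z f' + \<delta>)) = z f' + \<delta>" by linarith
    ultimately have "K dvd z f' + \<delta>" by (simp only:)
    then obtain x where x: "z f' + \<delta> = K * x" unfolding dvd_def by (elim exE)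
    have "sgn (K * int n - 0) = sgn (K * x)" using sg[of "\<lambda>f. 0"] x by (auto simp: W_def)
    moreover have "K * int n \<ge> 0" using K by simp
    ultimately have "K * x \<ge> 0" by (smt (verit) sgn_if)
    then have "x \<ge> 0" using K by (simp add: zero_le_mult_iff)
    then obtain n' where n': "x = int n'" by (metis zero_le_imp_eq_int)
    have Nd: "N dvd int n - int n'"
    proof -
      have "K * N dvd K * (int n - int n')"
        using Dd x n' by (simp add: D_def algebra_simps)
      then show ?thesis using K by simp
    qed
    have "sgn (t (f(v := n))) = sgn (t (f'(v := n')))" "t (f(v := n)) mod N = t (f'(v := n')) mod N"
      if t: "t \<in> T" for t
    proof -
      have ut: "sgn (u t f) = sgn (u t f')" "u t f mod D = u t f' mod D"
        using ag t by (auto simp: agree_def T'_def)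
      show "sgn (t (f(v := n))) = sgn (t (f'(v := n')))"
      proof (cases "k t = 0")
        case True
        then show ?thesis using ut by (simp add: ku t)
      next
        case False
        then have t1: "t \<in> T1" using t by (simp add: T1_def)
        then have "sgn (K * int n - w t f) = sgn (K * int n' - w t f')"
          using sg[of "w t"] x n' by (auto simp: W_def)
        then have "sgn (K * t (f(v := n))) = sgn (K * t (f'(v := n')))"
          using kw[OF t1] by (simp add: sgn_mult)
        then show ?thesis using K by (simp add: sgn_mult)
      qed
      have "D dvd u t f - u t f'" using ut(2) by (simp add: mod_eq_dvd_iff)
      then have "N dvd u t f - u t f'" unfolding D_def by (rule dvd_mult_right)
      then have "N dvd k t * (int n - int n') + (u t f - u t f')"
        using Nd by (intro dvd_add dvd_mult)
      then show "t (f(v := n)) mod N = t (f'(v := n')) mod N"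
        by (simp add: ku t mod_eq_dvd_iff algebra_simps)
    qed
    then have "agree T N (f(v := n)) (f'(v := n'))" by (simp add: agree_def)
    then have "P (f(v := n)) = P (f'(v := n'))" using T(4) by simp
    with P show ?thesis by (intro exI[of _ n']) simp
  qed
  have "(\<exists>n. P (f(v := n))) = (\<exists>n. P (f'(v := n)))" if "agree T' D f f'" for f f'
    using step[OF that] step[OF agree_sym[OF that]] by (intro iffI; elim exE)
  with T' D show ?thesis unfolding pres_def
    by (intro exI[of _ T'] exI[of _ D] conjI allI impI)
qed

section \<open>Vanishing sums of powers\<close>

text \<open>The term of largest exponent has absolute value at least \<open>d ^ f j\<close> and must
  be cancelled by the others, which are too small for this unless the second largest exponent is
  close. Ties are the case \<open>\<delta> = 0\<close>.\<close>

lemma top_gap: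
  fixes c :: "'a \<Rightarrow> int" and f :: "'a \<Rightarrow> nat" and d :: nat
  assumes J: "finite J" "J \<noteq> {}" "\<forall>j\<in>J. c j \<noteq> 0" and d: "d \<ge> 2"
    and sum0: "(\<Sum>j\<in>J. c j * int d ^ f j) = 0"
  shows "\<exists>j\<in>J. \<exists>j'\<in>J - {j}. \<exists>\<delta>\<le>nat (\<Sum>i\<in>J. \<bar>c i\<bar>). f j = f j' + \<delta>"
proof -
  obtain j where j: "j \<in> J" "Max (f ` J) = f j"
    using J(1,2) by (rule obtains_MAX)
  have jmax: "f i \<le> f j" if "i \<in> J" for i
    using Max_ge[of "f ` J" "f i"] that J j by auto
  have split: "(\<Sum>i\<in>J. c i * int d ^ f i) = c j * int d ^ f j + (\<Sum>i\<in>J - {j}. c i * int d ^ f i)"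
    using J j by (simp add: sum.remove)
  have ne: "J - {j} \<noteq> {}"
  proof
    assume "J - {j} = {}"
    with split sum0 J(3) j d show False by simp
  qed
  obtain j' where j': "j' \<in> J - {j}" "Max (f ` (J - {j})) = f j'"
    using finite_Diff[OF J(1)] ne by (rule obtains_MAX)
  have j'max: "f i \<le> f j'" if "i \<in> J - {j}" for i
    using Max_ge[of "f ` (J - {j})" "f i"] that J j' by auto
  define \<delta> where "\<delta> = f j - f j'"
  have fj: "f j = f j' + \<delta>" using jmax[of j'] j' by (simp add: \<delta>_def)
  have cj: "c j * int d ^ f j = - (\<Sum>i\<in>J - {j}. c i * int d ^ f i)"
    using split sum0 by simp
  have "int d ^ \<delta> * int d ^ f j' = int d ^ f j" by (simp add: fj power_add)
  also have "\<dots> \<le> \<bar>c j\<bar> * int d ^ f j" using J(3) j by (intro mult_le_cancel_right1[THEN iffD2]) auto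
  also have "\<dots> = \<bar>\<Sum>i\<in>J - {j}. c i * int d ^ f i\<bar>"
    using arg_cong[OF cj, of abs] by (simp add: abs_mult)
  also have "\<dots> \<le> (\<Sum>i\<in>J - {j}. \<bar>c i\<bar> * int d ^ f i)"
    by (rule order_trans[OF sum_abs]) (simp add: abs_mult)
  also have "\<dots> \<le> (\<Sum>i\<in>J - {j}. \<bar>c i\<bar> * int d ^ f j')"
    using j'max d by (intro sum_mono mult_left_mono power_increasing) auto
  also have "\<dots> = (\<Sum>i\<in>J - {j}. \<bar>c i\<bar>) * int d ^ f j'"
    by (simp add: sum_distrib_right)
  finally have "int d ^ \<delta> \<le> (\<Sum>i\<in>J - {j}. \<bar>c i\<bar>)" using d by simp
  also have "\<dots> \<le> (\<Sum>i\<in>J. \<bar>c i\<bar>)" using J by (intro sum_mono2) auto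
  finally have "int d ^ \<delta> \<le> (\<Sum>i\<in>J. \<bar>c i\<bar>)" .
  moreover have "int \<delta> \<le> int d ^ \<delta>"
  proof -
    have "\<delta> < 2 ^ \<delta>" by (rule less_exp)
    also have "(2::nat) ^ \<delta> \<le> d ^ \<delta>" using d by (rule power_mono) simp
    finally have "int \<delta> < int (d ^ \<delta>)" by linarith
    then show ?thesis by simp
  qed
  ultimately have "\<delta> \<le> nat (\<Sum>i\<in>J. \<bar>c i\<bar>)" by linarith
  with j j' fj show ?thesis by (intro bexI exI conjI)
qed

text \<open>
  By \<open>top_gap\<close>, in a vanishing sum some two exponents have bounded difference, so that their
  two terms can be merged into one.
\<close>

lemma pres_expsum_aux:
  fixes c :: "nat \<Rightarrow> int"
  assumes "finite J" "d > 0"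
  shows "pres (\<lambda>f. (\<Sum>j\<in>J. c j * int d ^ f j) = 0)"
  using assms(1)
proof (induction "card J" arbitrary: J c rule: less_induct)
  case less
  consider "J = {}" | "d = 1" | j where "j \<in> J" "c j = 0" 
    | "J \<noteq> {}" "d \<ge> 2" "\<forall>j\<in>J. c j \<noteq> 0"
    using assms(2) by (metis One_nat_def Suc_leI le_neq_implies_less numeral_2_eq_2)
  then show ?case
  proof cases
    case 1
    then show ?thesis by (simp add: pres_const)
  next
    case 2
    then show ?thesis by (simp add: pres_const)
  next
    case 3
    have "pres (\<lambda>f. (\<Sum>j\<in>J - {j}. c j * int d ^ f j) = 0)"
      using less.prems 3 by (intro less.hyps card_Diff1_less) auto
    moreover have "(\<Sum>j\<in>J. c j * int d ^ f j) = (\<Sum>j\<in>J - {j}. c j * int d ^ f j)" for f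
      using less.prems 3 by (simp add: sum.remove[of J j])
    ultimately show ?thesis by simp
  next
    case 4
    define S where "S = Sigma J (\<lambda>j. (J - {j}) \<times> {..nat (\<Sum>i\<in>J. \<bar>c i\<bar>)})"
    define c' where "c' j j' \<delta> = c(j' := c j' + c j * int d ^ \<delta>)" for j j' \<delta>
    define R where "R = (\<lambda>(j, j', \<delta>) (f :: nat \<Rightarrow> nat). int (f j) - (int (f j') + int \<delta>) = 0 \<and>
       (\<Sum>i\<in>J - {j}. c' j j' \<delta> i * int d ^ f i) = 0)"
    have "finite S" using less.prems unfolding S_def by (intro finite_SigmaI) auto
    moreover have "pres (R x)" if x: "x \<in> S" for x
    proof -
      obtain j j' \<delta> where jj: "x = (j, j', \<delta>)" "j \<in> J" using x by (auto simp: S_def)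
      have "pres (\<lambda>f. int (f j) - (int (f j') + int \<delta>) = 0)"
        by (intro pres_eq0 zspan_diff zspan.add aff_var aff_const)
      moreover have "pres (\<lambda>f. (\<Sum>i\<in>J - {j}. c' j j' \<delta> i * int d ^ f i) = 0)"
        using less.prems jj by (intro less.hyps card_Diff1_less) auto
      ultimately show ?thesis unfolding R_def jj prod.case by (rule pres_conj)
    qed
    ultimately have "pres (\<lambda>f. \<exists>x\<in>S. R x f)" by (rule pres_bex)
    moreover have "(\<exists>x\<in>S. R x f) \<longleftrightarrow> (\<Sum>j\<in>J. c j * int d ^ f j) = 0" for f
    proof -
      have eq: "(\<Sum>i\<in>J. c i * int d ^ f i) = (\<Sum>i\<in>J - {j}. c' j j' \<delta> i * int d ^ f i)"
        if "j \<in> J" "j' \<in> J - {j}" "f j = f j' + \<delta>" for j j' \<delta>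
      proof -
        have "(\<Sum>i\<in>J - {j}. c' j j' \<delta> i * int d ^ f i) =
            c' j j' \<delta> j' * int d ^ f j' + (\<Sum>i\<in>J - {j} - {j'}. c' j j' \<delta> i * int d ^ f i)"
          using that less.prems by (intro sum.remove) auto
        also have "(\<Sum>i\<in>J - {j} - {j'}. c' j j' \<delta> i * int d ^ f i) =
            (\<Sum>i\<in>J - {j} - {j'}. c i * int d ^ f i)"
          by (intro sum.cong) (auto simp: c'_def)
        also have "c' j j' \<delta> j' * int d ^ f j' = c j * int d ^ f j + c j' * int d ^ f j'"
          using that by (simp add: c'_def power_add algebra_simps)
        finally have "(\<Sum>i\<in>J - {j}. c' j j' \<delta> i * int d ^ f i) = c j * int d ^ f j +
          (c j' * int d ^ f j' + (\<Sum>i\<in>J - {j} - {j'}. c i * int d ^ f i))" by simp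
        also have "c j' * int d ^ f j' + (\<Sum>i\<in>J - {j} - {j'}. c i * int d ^ f i) =
          (\<Sum>i\<in>J - {j}. c i * int d ^ f i)"
          using that less.prems by (intro sum.remove[symmetric]) auto
        also have "c j * int d ^ f j + \<dots> = (\<Sum>i\<in>J. c i * int d ^ f i)"
          using that less.prems by (intro sum.remove[symmetric]) auto
        finally show ?thesis ..
      qed
      show ?thesis
      proof
        assume "\<exists>x\<in>S. R x f"
        then obtain x where "x \<in> S" "R x f" ..
        then obtain j j' \<delta> where "j \<in> J" "j' \<in> J - {j}" "int (f j) - (int (f j') + int \<delta>) = 0"
          "(\<Sum>i\<in>J - {j}. c' j j' \<delta> i * int d ^ f i) = 0" by (auto simp: S_def R_def)
        moreover from this have "f j = f j' + \<delta>" by linarith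
        ultimately show "(\<Sum>j\<in>J. c j * int d ^ f j) = 0" using eq[of j j' \<delta>] by simp
      next
        assume 0: "(\<Sum>j\<in>J. c j * int d ^ f j) = 0"
        with top_gap[OF less.prems 4(1,3,2) 0] obtain j j' \<delta> where
          j: "j \<in> J" "j' \<in> J - {j}" "\<delta> \<le> nat (\<Sum>i\<in>J. \<bar>c i\<bar>)" "f j = f j' + \<delta>" by blast
        then have "(j, j', \<delta>) \<in> S" by (simp add: S_def)
        moreover have "R (j, j', \<delta>) f" using 0 eq[OF j(1,2,4)] j(4) by (simp add: R_def)
        ultimately show "\<exists>x\<in>S. R x f" ..
      qed
    qed
    ultimately show ?thesis by simp
  qed
qed

lemma pres_expsum_eq0:
  assumes "expsum d g" "d > 0"
  shows "pres (\<lambda>f. g f = 0)"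
proof -
  obtain c m where "g = (\<lambda>f. \<Sum>j<m. c j * int d ^ f j)"
    using zspan_range_sum[OF assms(1)] by metis
  then show ?thesis using pres_expsum_aux[of "{..<m}" d c] assms by simp
qed

text \<open>By the pigeonhole principle two powers agree, and their distance is a period from the
  smaller one on. There may be a preperiod, as \<open>b\<close> need not be invertible modulo
  \<open>N\<close>.\<close>

lemma power_mod_eventually_periodic:
  fixes b N :: int
  assumes "N > 0"
  shows "\<exists>(a::nat) (p::nat). p > 0 \<and>
    (\<forall>n n'. a \<le> n \<longrightarrow> a \<le> n' \<longrightarrow> n mod p = n' mod p \<longrightarrow> b ^ n mod N = b ^ n' mod N)"
proof -
  have "(\<lambda>n. b ^ n mod N) ` UNIV \<subseteq> {0..<N}" using assms by auto
  then have "finite (range (\<lambda>n. b ^ n mod N))" by (rule finite_subset) simp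
  then have "\<not> inj (\<lambda>n::nat. b ^ n mod N)" using finite_imageD infinite_UNIV_nat by blast
  then obtain x y :: nat where xy: "x \<noteq> y" "b ^ x mod N = b ^ y mod N" unfolding inj_def by blast
  define a where "a = min x y"
  define p where "p = max x y - a"
  have p: "p > 0" and per: "b ^ (a + p) mod N = b ^ a mod N"
    using xy by (auto simp: a_def p_def min_def max_def split: if_splits)
  have shift: "b ^ (a + i + p) mod N = b ^ (a + i) mod N" for i
  proof -
    have "b ^ (a + i + p) mod N = (b ^ (a + p) mod N * b ^ i) mod N"
      by (simp only: mod_mult_left_eq) (simp add: power_add ac_simps)
    also have "\<dots> = (b ^ a mod N * b ^ i) mod N" by (simp only: per)
    also have "\<dots> = b ^ (a + i) mod N" by (simp add: mod_mult_left_eq power_add)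
    finally show ?thesis .
  qed
  have mult: "b ^ (a + i + k * p) mod N = b ^ (a + i) mod N" for i k
  proof (induction k)
    case (Suc k)
    then show ?case using shift[of "i + k * p"] by (simp add: ac_simps)
  qed simp
  have red: "b ^ n mod N = b ^ (a + (n - a) mod p) mod N" if "a \<le> n" for n
    using mult[of "(n - a) mod p" "(n - a) div p"] that by (simp add: add.assoc)
  show ?thesis
  proof (rule exI[of _ a], rule exI[of _ p], intro conjI allI impI)
    fix n n' assume n: "a \<le> n" "a \<le> n'" "n mod p = n' mod p"
    have "(n - a) mod p = (n' - a) mod p"
    proof -
      have "int p dvd int n - int n'" using n(3) by (metis mod_eq_dvd_iff of_nat_mod)
      then have "int p dvd int (n - a) - int (n' - a)" using n(1,2) by (simp add: of_nat_diff)
      then have "int (n - a) mod int p = int (n' - a) mod int p" by (simp add: mod_eq_dvd_iff)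
      then show ?thesis by (metis of_nat_eq_iff of_nat_mod)
    qed
    then show "b ^ n mod N = b ^ n' mod N" using red[OF n(1)] red[OF n(2)] by simp
  qed (rule p)
qed

lemma pres_expsum_mod:
  assumes "expsum d g" "N > 0"
  shows "pres (\<lambda>f. g f mod N = r)"
  using assms(1)
proof (induction arbitrary: r rule: zspan.induct)
  case (base b)
  then obtain i where i: "b = (\<lambda>f. int d ^ f i)" by auto
  obtain a p where ap: "p > 0" "\<forall>n n'. a \<le> n \<longrightarrow> a \<le> n' \<longrightarrow> n mod p = n' mod p \<longrightarrow>
      int d ^ n mod N = int d ^ n' mod N"
    using power_mod_eventually_periodic[OF assms(2), of "int d"] by (elim exE conjE)
  \<comment> \<open>The signs of \<open>f i - j\<close> determine \<open>f i\<close> exactly up to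
    the preperiod \<open>a\<close>; beyond it the residue of \<open>f i\<close> modulo
    \<open>p\<close> suffices.\<close>
  define T where "T = insert (\<lambda>f :: nat \<Rightarrow> nat. int (f i)) ((\<lambda>j f. int (f i) - int j) ` {..a})"
  have T: "finite T" "\<forall>t\<in>T. aff t"
    by (auto simp: T_def intro!: zspan_diff aff_var aff_const)
  have "int d ^ f i mod N = int d ^ f' i mod N" if "agree T (int p) f f'" for f f'
  proof -
    have "int (f i) mod int p = int (f' i) mod int p" using that by (simp add: agree_def T_def)
    then have m: "f i mod p = f' i mod p" by (metis of_nat_eq_iff of_nat_mod)
    have s: "sgn (int (f i) - int j) = sgn (int (f' i) - int j)" if "j \<le> a" for j
      using that \<open>agree T (int p) f f'\<close> by (simp add: agree_def T_def)
    show ?thesis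
    proof (cases "f i \<le> a")
      case True
      then have "f i = f' i" using s[of "f i"] by (simp add: sgn_if split: if_splits)
      then show ?thesis by simp
    next
      case False
      then have "a \<le> f' i" using s[of a] by (simp add: sgn_if split: if_splits)
      with False m show ?thesis by (intro ap(2)[rule_format]) auto
    qed
  qed
  with T ap(1) show ?case unfolding i pres_def
    by (intro exI[of _ T] exI[of _ "int p"] conjI allI impI) auto
next
  case (add s t)
  \<comment> \<open>The residue \<open>r\<close> need not be reduced; the last conjunct makes the
    predicate false if it is not.\<close>
  have "pres (\<lambda>f. \<exists>x\<in>{0..<N}. s f mod N = x \<and> t f mod N = (r - x) mod N \<and> r mod N = r)"
    by (intro pres_bex pres_conj add.IH pres_const) simp
  moreover have "(\<exists>x\<in>{0..<N}. s f mod N = x \<and> t f mod N = (r - x) mod N \<and> r mod N = r) \<longleftrightarrow>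
      (s f + t f) mod N = r" for f
  proof -
    have "(t f mod N = (r - s f mod N) mod N \<and> r mod N = r) \<longleftrightarrow> (s f + t f) mod N = r"
    proof -
      have "(t f mod N = (r - s f mod N) mod N) \<longleftrightarrow> (s f + t f) mod N = r mod N"
        by (simp add: mod_diff_right_eq mod_eq_dvd_iff algebra_simps)
      then show ?thesis by auto
    qed
    moreover have "s f mod N \<in> {0..<N}" using assms(2) by simp
    ultimately show ?thesis by auto
  qed
  ultimately show ?case by simp
next
  case (scale t c)
  have "pres (\<lambda>f. \<exists>x\<in>{0..<N}. t f mod N = x \<and> (c * x) mod N = r)"
    by (intro pres_bex pres_conj scale.IH pres_const) simp
  moreover have "(\<exists>x\<in>{0..<N}. t f mod N = x \<and> (c * x) mod N = r) \<longleftrightarrow> (c * t f) mod N = r" for f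
    using assms(2) by (auto simp: mod_mult_right_eq)
  ultimately show ?case by simp
qed

section \<open>Elements avoiding sums of powers\<close>

text \<open>With \<open>n = m * (k + 1)\<close> one has \<open>2 ^ n = 2 ^ m * (2 ^ m) ^ k\<close>,
  so it suffices that \<open>C < 2 ^ m\<close> and \<open>n + c \<le> 2 ^ m\<close>. Taking
  \<open>m = 2 * j\<close> gives \<open>2 ^ m \<ge> (j + 1) * (j + 1)\<close>, and \<open>j\<close>
  is large enough for both.\<close>

lemma poly_less_exp: "\<exists>n\<ge>1. C * (n + c) ^ k < (2::nat) ^ n"
proof -
  define j where "j = 2 * (k + 1) + c + C"
  define m where "m = 2 * j"
  have j: "2 * (k + 1) \<le> j" "c \<le> j" "C \<le> j" by (auto simp: j_def)
  have "j + 1 \<le> 2 ^ j" using less_exp[of j] by linarith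
  then have "(j + 1) * (j + 1) \<le> 2 ^ j * (2::nat) ^ j" by (intro mult_le_mono)
  then have m: "(j + 1) * (j + 1) \<le> (2::nat) ^ m" by (simp add: m_def mult_2 power_add)
  have "m * (k + 1) + c \<le> j * j + j"
  proof -
    have "m * (k + 1) = 2 * (k + 1) * j" by (simp add: m_def)
    also have "\<dots> \<le> j * j" by (rule mult_le_mono1[OF j(1)])
    finally show ?thesis using j(2) by linarith
  qed
  also have "\<dots> \<le> 2 ^ m" using m by simp
  finally have n: "m * (k + 1) + c \<le> 2 ^ m" .
  have "C < 2 ^ m"
  proof -
    have "C < (j + 1) * (j + 1)" using j(3) by simp
    with m show ?thesis by linarith
  qed
  then have "C * (2 ^ m) ^ k < 2 ^ m * (2 ^ m) ^ k" by simp
  moreover have "C * (m * (k + 1) + c) ^ k \<le> C * (2 ^ m) ^ k"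
    using n by (intro mult_le_mono2 power_mono) auto
  moreover have "(2::nat) ^ m * (2 ^ m) ^ k = 2 ^ (m * (k + 1))"
    by (simp add: power_mult[symmetric] power_add)
  ultimately have "C * (m * (k + 1) + c) ^ k < 2 ^ (m * (k + 1))" by linarith
  moreover have "m * (k + 1) \<ge> 1" using j(1) by (simp add: m_def)
  ultimately show ?thesis by blast
qed

text \<open>The exponent \<open>m\<close>, in essence the number of powers in \<open>g\<close>, is
  uniform in \<open>q\<close> and \<open>\<kappa>\<close>, because the modulus is chosen only after
  \<open>m\<close> is known.\<close>

definition residues_bound :: "nat \<Rightarrow> ('a \<Rightarrow> int) \<Rightarrow> nat \<Rightarrow> bool" where
  "residues_bound d g m \<longleftrightarrow> (\<forall>q>0. \<forall>\<kappa>\<ge>1. card (range (\<lambda>n. int d ^ n mod q)) \<le> \<kappa> \<longrightarrow>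
     card (range (\<lambda>f. g f mod q)) \<le> \<kappa> ^ m)"

lemma finite_residues: "q > 0 \<Longrightarrow> finite (range (\<lambda>x. u x mod q))" for q :: int
  by (rule finite_subset[of _ "{0..<q}"]) auto

lemma residues_bound_add:
  assumes "residues_bound d s m" "residues_bound d t m'"
  shows "residues_bound d (\<lambda>f. s f + t f) (m + m')"
  unfolding residues_bound_def
proof (intro allI impI)
  fix q :: int and \<kappa> :: nat
  assume q: "q > 0" "\<kappa> \<ge> 1" "card (range (\<lambda>n. int d ^ n mod q)) \<le> \<kappa>"
  let ?S = "range (\<lambda>f. s f mod q)" and ?T = "range (\<lambda>f. t f mod q)"
  have "range (\<lambda>f. (s f + t f) mod q) \<subseteq> (\<lambda>(a, b). (a + b) mod q) ` (?S \<times> ?T)"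
  proof (rule image_subsetI)
    fix f
    show "(s f + t f) mod q \<in> (\<lambda>(a, b). (a + b) mod q) ` (?S \<times> ?T)"
      by (rule image_eqI[of _ _ "(s f mod q, t f mod q)"]) (auto simp: mod_add_eq)
  qed
  then have "card (range (\<lambda>f. (s f + t f) mod q)) \<le> card (?S \<times> ?T)"
    using finite_residues[OF q(1)] by (intro surj_card_le) auto
  also have "\<dots> \<le> \<kappa> ^ m * \<kappa> ^ m'"
    using assms q unfolding residues_bound_def card_cartesian_product by (intro mult_le_mono) simp_all
  finally show "card (range (\<lambda>f. (s f + t f) mod q)) \<le> \<kappa> ^ (m + m')"
    by (simp add: power_add)
qed

lemma residues_bound_scale:
  assumes "residues_bound d t m"
  shows "residues_bound d (\<lambda>f. c * t f) m"
  unfolding residues_bound_def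
proof (intro allI impI)
  fix q :: int and \<kappa> :: nat
  assume q: "q > 0" "\<kappa> \<ge> 1" "card (range (\<lambda>n. int d ^ n mod q)) \<le> \<kappa>"
  have "range (\<lambda>f. (c * t f) mod q) \<subseteq> (\<lambda>a. (c * a) mod q) ` range (\<lambda>f. t f mod q)"
  proof (rule image_subsetI)
    fix f
    show "(c * t f) mod q \<in> (\<lambda>a. (c * a) mod q) ` range (\<lambda>f. t f mod q)"
      by (rule image_eqI[of _ _ "t f mod q"]) (auto simp: mod_mult_right_eq)
  qed
  then have "card (range (\<lambda>f. (c * t f) mod q)) \<le> card (range (\<lambda>f. t f mod q))"
    using finite_residues[OF q(1)] by (intro surj_card_le) auto
  also have "\<dots> \<le> \<kappa> ^ m" using assms q unfolding residues_bound_def by simp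
  finally show "card (range (\<lambda>f. (c * t f) mod q)) \<le> \<kappa> ^ m" .
qed

lemma expsum_residues_bound: "expsum d g \<Longrightarrow> \<exists>m. residues_bound d g m"
proof (induction rule: zspan.induct)
  case (base b)
  then obtain i where i: "b = (\<lambda>f. int d ^ f i)" by auto
  have "card (range (\<lambda>f :: nat \<Rightarrow> nat. int d ^ f i mod q)) \<le> card (range (\<lambda>n. int d ^ n mod q))"
    if "q > 0" for q
    using finite_residues[OF that, of "\<lambda>n. int d ^ n"] by (intro card_mono) auto
  then have "residues_bound d b 1"
    unfolding residues_bound_def i power_one_right by (meson order_trans)
  then show ?case ..
next
  case (add s t)
  then show ?case by (elim exE) (rule exI, rule residues_bound_add)
next
  case (scale t c)
  then show ?case by (elim exE) (rule exI, rule residues_bound_scale)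
qed

text \<open>
  For \<open>d \<ge> 2\<close> take \<open>q = d^\<kappa> - 1\<close>, modulo which \<open>d\<close> has order at most \<open>\<kappa>\<close>.
\<close>

lemma modulus_few_powers:
  assumes "d > 0"
  shows "\<exists>q \<kappa>. q > 0 \<and> \<kappa> \<ge> 1 \<and> card (range (\<lambda>n. int d ^ n mod int q)) \<le> \<kappa> \<and> C * \<kappa> ^ m \<le> q"
proof (cases "d = 1")
  case True
  then show ?thesis by (intro exI[of _ "C + 1"] exI[of _ 1]) auto
next
  case False
  with assms have d: "d \<ge> 2" by simp
  obtain \<kappa> where \<kappa>: "\<kappa> \<ge> 1" "C * (\<kappa> + 0) ^ m < 2 ^ \<kappa>" using poly_less_exp by blast
  define q where "q = d ^ \<kappa> - 1"
  have "2 ^ \<kappa> \<le> d ^ \<kappa>" using d by (rule power_mono) simp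
  moreover have "(2::nat) ^ 1 \<le> 2 ^ \<kappa>" using \<kappa>(1) by (intro power_increasing) auto
  ultimately have q: "q > 0" "C * \<kappa> ^ m \<le> q" using \<kappa>(2) by (auto simp: q_def)
  have "int d ^ \<kappa> - 1 = int q" using q(1) by (simp add: q_def of_nat_diff)
  then have "int d ^ \<kappa> mod int q = 1 mod int q" by (metis dvd_refl mod_eq_dvd_iff)
  then have "(int d ^ \<kappa>) ^ i mod int q = 1 mod int q" for i by (metis power_mod power_one)
  then have per: "int d ^ n mod int q = int d ^ (n mod \<kappa>) mod int q" for n
  proof -
    have "int d ^ n = (int d ^ \<kappa>) ^ (n div \<kappa>) * int d ^ (n mod \<kappa>)"
      by (simp flip: power_mult power_add)
    also have "\<dots> mod int q = ((int d ^ \<kappa>) ^ (n div \<kappa>) mod int q * int d ^ (n mod \<kappa>)) mod int q"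
      by (simp only: mod_mult_left_eq)
    also have "\<dots> = (1 mod int q * int d ^ (n mod \<kappa>)) mod int q"
      by (simp only: \<open>\<And>i. (int d ^ \<kappa>) ^ i mod int q = 1 mod int q\<close>)
    finally show ?thesis by (simp only: mod_mult_left_eq mult_1)
  qed
  have "range (\<lambda>n. int d ^ n mod int q) \<subseteq> (\<lambda>n. int d ^ n mod int q) ` {..<\<kappa>}"
  proof (rule image_subsetI)
    fix n
    have "n mod \<kappa> \<in> {..<\<kappa>}" using \<kappa>(1) by simp
    then show "int d ^ n mod int q \<in> (\<lambda>n. int d ^ n mod int q) ` {..<\<kappa>}"
      using per by (rule image_eqI[where x = "n mod \<kappa>", rotated])
  qed
  then have "card (range (\<lambda>n. int d ^ n mod int q)) \<le> card {..<\<kappa>}"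
    by (intro surj_card_le) auto
  with q \<kappa>(1) show ?thesis by (intro exI[of _ q] exI[of _ \<kappa>]) auto
qed

definition avoids ::
    "(int \<times> ((nat \<Rightarrow> int) \<Rightarrow> int) \<times> ((nat \<Rightarrow> nat) \<Rightarrow> int)) set \<Rightarrow> (nat \<Rightarrow> int) \<Rightarrow> int \<Rightarrow> bool" where
  "avoids A e x \<longleftrightarrow> (\<forall>(k, t, g)\<in>A. \<forall>h. k * x + t e + g h \<noteq> 0)"

text \<open>Among the candidates \<open>r + N * y\<close> with \<open>0 \<le> y < Y\<close>, those
  excluded by one equation give distinct residues modulo \<open>q\<close>, all of them residues of a
  sum of powers. So each equation excludes at most \<open>\<kappa> ^ M\<close> of them, and
  \<open>Y\<close> exceeds the total.\<close>

lemma avoiding_element_exists: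
  assumes A: "finite A" "\<forall>(k, t, g)\<in>A. k \<noteq> 0 \<and> expsum d g" and d: "d > 0" and N: "N > 0"
  shows "\<exists>x. x mod N = r mod N \<and> avoids A e x"
proof -
  have "\<forall>a\<in>A. \<exists>m. residues_bound d (snd (snd a)) m"
    using A(2) by (intro ballI expsum_residues_bound) auto
  then obtain m where m: "\<forall>a\<in>A. residues_bound d (snd (snd a)) (m a)" by (auto dest: bchoice)
  define M where "M = (\<Sum>a\<in>A. m a)"
  define S where "S = (\<Sum>a\<in>A. \<bar>fst a\<bar>)"
  \<comment> \<open>\<open>Kb\<close> exceeds \<open>\<bar>k * N\<bar>\<close> for every leading
    coefficient \<open>k\<close>; with \<open>Kb * Y \<le> q\<close> this keeps differences of
    candidate values below \<open>q\<close>.\<close>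
  define Kb where "Kb = nat (N * S + 1)"
  obtain q \<kappa> where q: "q > 0" "\<kappa> \<ge> 1" "card (range (\<lambda>n. int d ^ n mod int q)) \<le> \<kappa>"
    "(card A + 1) * Kb * \<kappa> ^ M \<le> q" using modulus_few_powers[OF d] by blast
  define Y where "Y = card A * \<kappa> ^ M + 1"
  have "Y \<le> (card A + 1) * \<kappa> ^ M" using q(2) by (simp add: Y_def)
  then have "Kb * Y \<le> Kb * ((card A + 1) * \<kappa> ^ M)" by simp
  also have "\<dots> \<le> q" using q(4) by (simp add: algebra_simps)
  finally have Yq: "int Kb * int Y \<le> int q" by (metis of_nat_le_iff of_nat_mult)
  define bad where "bad a = {y \<in> {0..<int Y}. \<exists>h. fst a * (r + N * y) + fst (snd a) e + snd (snd a) h = 0}"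
    for a :: "int \<times> ((nat \<Rightarrow> int) \<Rightarrow> int) \<times> ((nat \<Rightarrow> nat) \<Rightarrow> int)"
  have bad: "card (bad a) \<le> \<kappa> ^ M" if a: "a \<in> A" for a
  proof -
    define \<phi> where "\<phi> y = (- (fst a * (r + N * y) + fst (snd a) e)) mod int q" for y
    have k: "fst a \<noteq> 0" using A(2) a by auto
    have "\<bar>fst a\<bar> \<le> S" unfolding S_def using A(1) a by (intro member_le_sum) auto
    then have "N * \<bar>fst a\<bar> \<le> N * S" using N by simp
    moreover have "int Kb = N * S + 1" using N by (simp add: Kb_def S_def sum_nonneg)
    moreover have "\<bar>fst a * N\<bar> = N * \<bar>fst a\<bar>" using N by (simp add: abs_mult)
    ultimately have kN: "\<bar>fst a * N\<bar> < int Kb" by linarith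
    have "inj_on \<phi> (bad a)"
    proof (rule inj_onI)
      fix y y' assume y: "y \<in> bad a" "y' \<in> bad a" "\<phi> y = \<phi> y'"
      from y(3) have "int q dvd (- (fst a * (r + N * y) + fst (snd a) e)) - (- (fst a * (r + N * y') + fst (snd a) e))"
        unfolding \<phi>_def by (simp only: mod_eq_dvd_iff)
      then have dv: "int q dvd fst a * N * (y' - y)" by (simp add: algebra_simps)
      have "\<bar>y' - y\<bar> < int Y" using y(1,2) by (auto simp: bad_def)
      then have "\<bar>fst a * N\<bar> * \<bar>y' - y\<bar> < int Kb * int Y"
        using kN by (intro mult_strict_mono') auto
      then have "\<bar>fst a * N * (y' - y)\<bar> < int q" using Yq by (simp add: abs_mult)
      then have "fst a * N * (y' - y) = 0" using dv dvd_imp_le_int[of "fst a * N * (y' - y)" "int q"] by force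
      then show "y = y'" using k N by simp
    qed
    moreover have "\<phi> ` bad a \<subseteq> range (\<lambda>f. snd (snd a) f mod int q)"
    proof
      fix z assume "z \<in> \<phi> ` bad a"
      then obtain y h where "z = \<phi> y" "fst a * (r + N * y) + fst (snd a) e + snd (snd a) h = 0"
        by (auto simp: bad_def)
      moreover from this(2) have "- (fst a * (r + N * y) + fst (snd a) e) = snd (snd a) h" by linarith
      ultimately show "z \<in> range (\<lambda>f. snd (snd a) f mod int q)" unfolding \<phi>_def by simp
    qed
    moreover have "finite (range (\<lambda>f. snd (snd a) f mod int q))"
      by (rule finite_subset[of _ "{0..<int q}"]) (use q(1) in auto)
    ultimately have "card (bad a) \<le> card (range (\<lambda>f. snd (snd a) f mod int q))"
      by (rule card_inj_on_le)
    also have "\<dots> \<le> \<kappa> ^ m a" using m a q(1-3) by (simp add: residues_bound_def)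
    also have "\<dots> \<le> \<kappa> ^ M" using q(2) A(1) a unfolding M_def
      by (intro power_increasing member_le_sum) auto
    finally show ?thesis .
  qed
  have "card (\<Union>a\<in>A. bad a) \<le> (\<Sum>a\<in>A. card (bad a))" using A(1) by (rule card_UN_le)
  also have "\<dots> \<le> (\<Sum>a\<in>A. \<kappa> ^ M)" using bad by (rule sum_mono)
  also have "\<dots> < Y" by (simp add: Y_def)
  also have "Y = card {0..<int Y}" by simp
  finally have lt: "card (\<Union>a\<in>A. bad a) < card {0..<int Y}" .
  have "finite (\<Union>a\<in>A. bad a)"
    by (rule finite_subset[of _ "{0..<int Y}"]) (auto simp: bad_def)
  then have "\<not> {0..<int Y} \<subseteq> (\<Union>a\<in>A. bad a)"
    using lt card_mono leD by blast
  then obtain y where y: "y \<in> {0..<int Y}" "y \<notin> (\<Union>a\<in>A. bad a)" by blast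
  then have "avoids A e (r + N * y)" by (auto simp: avoids_def bad_def)
  then show ?thesis by (intro exI[of _ "r + N * y"]) simp
qed

section \<open>Elimination of integer quantifiers\<close>

text \<open>
  Predicates defined by formulas all of whose quantifiers range over exponents; \<open>e\<close> assigns
  values to the integer variables and \<open>f\<close> to the exponent variables.
\<close>

inductive bdef :: "nat \<Rightarrow> ((nat \<Rightarrow> int) \<Rightarrow> (nat \<Rightarrow> nat) \<Rightarrow> bool) \<Rightarrow> bool" for d where
  eq: "lin t \<Longrightarrow> expsum d g \<Longrightarrow> bdef d (\<lambda>e f. t e + g f = 0)"
| cong: "lin t \<Longrightarrow> expsum d g \<Longrightarrow> N > 0 \<Longrightarrow> bdef d (\<lambda>e f. (t e + g f) mod N = r)"
| pres: "pres P \<Longrightarrow> bdef d (\<lambda>e f. P f)"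
| neg: "bdef d P \<Longrightarrow> bdef d (\<lambda>e f. \<not> P e f)"
| conj: "bdef d P \<Longrightarrow> bdef d Q \<Longrightarrow> bdef d (\<lambda>e f. P e f \<and> Q e f)"
| ex: "bdef d P \<Longrightarrow> bdef d (\<lambda>e f. \<exists>n. P e (f(v := n)))"

lemma bdef_disj: "bdef d P \<Longrightarrow> bdef d Q \<Longrightarrow> bdef d (\<lambda>e f. P e f \<or> Q e f)"
  using bdef.neg[OF bdef.conj[OF bdef.neg bdef.neg], of d P Q] by simp

lemma bdef_bex: 
  assumes "finite S" "\<And>x. x \<in> S \<Longrightarrow> bdef d (P x)"
  shows "bdef d (\<lambda>e f. \<exists>x\<in>S. P x e f)"
  using assms
proof (induction S)
  case empty
  show ?case using bdef.pres[OF pres_const] by simp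
next
  case (insert x S)
  then have "bdef d (\<lambda>e f. P x e f \<or> (\<exists>x\<in>S. P x e f))" by (intro bdef_disj) auto
  then show ?case by simp
qed

lemma bdef_ex_finite:
  assumes "finite I" "bdef d R"
  shows "bdef d (\<lambda>e f. \<exists>h. R e (\<lambda>i. if i \<in> I then h i else f i))"
  using assms(1)
proof (induction I)
  case empty
  show ?case using assms(2) by simp
next
  case (insert v I)
  have "bdef d (\<lambda>e f. \<exists>n. \<exists>h. R e (\<lambda>i. if i \<in> I then h i else (f(v := n)) i))"
    using insert.IH by (rule bdef.ex)
  moreover have "(\<exists>n. \<exists>h. R e (\<lambda>i. if i \<in> I then h i else (f(v := n)) i)) \<longleftrightarrow>
      (\<exists>h. R e (\<lambda>i. if i \<in> insert v I then h i else f i))" for e f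
  proof
    assume "\<exists>n. \<exists>h. R e (\<lambda>i. if i \<in> I then h i else (f(v := n)) i)"
    then obtain n h where "R e (\<lambda>i. if i \<in> I then h i else (f(v := n)) i)" by (elim exE)
    moreover have "(\<lambda>i. if i \<in> I then h i else (f(v := n)) i) =
        (\<lambda>i. if i \<in> insert v I then (if i \<in> I then h i else n) else f i)" by auto
    ultimately show "\<exists>h. R e (\<lambda>i. if i \<in> insert v I then h i else f i)"
      by (intro exI[of _ "\<lambda>i. if i \<in> I then h i else n"]) simp
  next
    assume "\<exists>h. R e (\<lambda>i. if i \<in> insert v I then h i else f i)"
    then obtain h where "R e (\<lambda>i. if i \<in> insert v I then h i else f i)" ..
    moreover have "(\<lambda>i. if i \<in> insert v I then h i else f i) =
        (\<lambda>i. if i \<in> I then h i else (f(v := h v)) i)" by auto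
    ultimately show "\<exists>n. \<exists>h. R e (\<lambda>i. if i \<in> I then h i else (f(v := n)) i)"
      by (intro exI[of _ "h v"] exI[of _ h]) simp
  qed
  ultimately show ?case by simp
qed

text \<open>An equation with a nonzero coefficient at \<open>x\<close> fails by avoidance, one with
  coefficient 0 does not see \<open>x\<close>, and a congruence sees only the residue of
  \<open>x\<close>. As \<open>avoids\<close> refers to all exponents, the same \<open>A\<close> and
  \<open>N\<close> survive exponent quantifiers.\<close>

lemma bdef_generic:
  assumes "bdef d P"
  shows "\<exists>A N. finite A \<and> N > 0 \<and> (\<forall>(k, t, g)\<in>A. k \<noteq> 0 \<and> lin t \<and> expsum d g) \<and>
    (\<forall>r. \<exists>P'. bdef d P' \<and>
      (\<forall>e f x. x mod N = r mod N \<longrightarrow> avoids A e x \<longrightarrow> P (e(v := x)) f = P' e f))"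
  using assms
proof (induction rule: bdef.induct)
  case (eq t g)
  obtain k t' where t': "lin t'" "\<forall>e x. t (e(v := x)) = k * x + t' e"
    using lin_split[OF eq(1), of v] by (elim exE conjE)
  show ?case
  proof (cases "k = 0")
    case True
    have "bdef d (\<lambda>e f. t' e + g f = 0)" using t'(1) eq(2) by (rule bdef.eq)
    moreover have "\<forall>e f x. (t (e(v := x)) + g f = 0) = (t' e + g f = 0)"
      using t'(2) True by (simp del: fun_upd_apply)
    ultimately show ?thesis
      by (intro exI[of _ "{}"] exI[of _ "1::int"] conjI allI exI[of _ "\<lambda>e f. t' e + g f = 0"]) (auto simp del: fun_upd_apply)
  next
    case False
    have "bdef d (\<lambda>e f. False)" using bdef.pres[OF pres_const] .
    moreover have "\<forall>e f x. avoids {(k, t', g)} e x \<longrightarrow> (t (e(v := x)) + g f = 0) = False"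
      using t'(2) by (auto simp: avoids_def simp del: fun_upd_apply)
    ultimately show ?thesis using False t'(1) eq(2)
      by (intro exI[of _ "{(k, t', g)}"] exI[of _ "1::int"] conjI allI exI[of _ "\<lambda>e f. False"]) (auto simp del: fun_upd_apply)
  qed
next
  case (cong t g N s)
  obtain k t' where t': "lin t'" "\<forall>e x. t (e(v := x)) = k * x + t' e"
    using lin_split[OF cong(1), of v] by (elim exE conjE)
  have "\<exists>P'. bdef d P' \<and> (\<forall>e f x. x mod N = r mod N \<longrightarrow> avoids {} e x \<longrightarrow>
      ((t (e(v := x)) + g f) mod N = s) = P' e f)" for r
  proof (intro exI conjI allI impI)
    \<comment> \<open>The congruence with \<open>x\<close> replaced by the representative
      \<open>r\<close>; the first conjunct again covers a right-hand side that is not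
      reduced.\<close>
    show "bdef d (\<lambda>e f. s mod N = s \<and> (t' e + g f) mod N = (s - k * r) mod N)"
      by (rule bdef.conj[OF bdef.pres[OF pres_const] bdef.cong[OF t'(1) cong(2,3)]])
    fix e f x assume "x mod N = r mod N"
    then have "N dvd x - r" by (simp add: mod_eq_dvd_iff)
    then have "N dvd k * (x - r)" by simp
    then have "N dvd k * x + t' e + g f - s \<longleftrightarrow> N dvd k * x + t' e + g f - s - k * (x - r)"
      using dvd_add_left_iff[of N "k * (x - r)" "k * x + t' e + g f - s - k * (x - r)"] by simp
    moreover have "k * x + t' e + g f - s - k * (x - r) = (t' e + g f) - (s - k * r)"
      by (simp add: algebra_simps)
    ultimately have "(k * x + t' e + g f) mod N = s mod N \<longleftrightarrow> (t' e + g f) mod N = (s - k * r) mod N"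
      by (simp only: mod_eq_dvd_iff)
    then show "((t (e(v := x)) + g f) mod N = s) =
        (s mod N = s \<and> (t' e + g f) mod N = (s - k * r) mod N)"
      using t'(2) by (auto simp: algebra_simps simp del: fun_upd_apply)
  qed
  with cong(3) show ?case by (intro exI[of _ "{}"] exI[of _ N]) (auto simp del: fun_upd_apply)
next
  case (pres P)
  show ?case
    by (intro exI[of _ "{}"] exI[of _ "1::int"] conjI allI exI[of _ "\<lambda>e f. P f"] bdef.pres[OF pres]) (auto simp del: fun_upd_apply)
next
  case (neg P)
  then obtain A N where A: "finite A" "N > 0" "\<forall>(k, t, g)\<in>A. k \<noteq> 0 \<and> lin t \<and> expsum d g" and
    P: "\<forall>r. \<exists>P'. bdef d P' \<and>
      (\<forall>e f x. x mod N = r mod N \<longrightarrow> avoids A e x \<longrightarrow> P (e(v := x)) f = P' e f)"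
    by (elim exE conjE)
  have "\<exists>P'. bdef d P' \<and>
      (\<forall>e f x. x mod N = r mod N \<longrightarrow> avoids A e x \<longrightarrow> (\<not> P (e(v := x)) f) = P' e f)" for r
  proof -
    from P obtain P' where "bdef d P'"
      "\<forall>e f x. x mod N = r mod N \<longrightarrow> avoids A e x \<longrightarrow> P (e(v := x)) f = P' e f" by metis
    then show ?thesis by (intro exI[of _ "\<lambda>e f. \<not> P' e f"] conjI bdef.neg) (auto simp del: fun_upd_apply)
  qed
  with A show ?case by (intro exI[of _ A] exI[of _ N]) (auto simp del: fun_upd_apply)
next
  case (conj P Q)
  obtain A N where A: "finite A" "N > 0" "\<forall>(k, t, g)\<in>A. k \<noteq> 0 \<and> lin t \<and> expsum d g" and
    P: "\<forall>r. \<exists>P'. bdef d P' \<and>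
      (\<forall>e f x. x mod N = r mod N \<longrightarrow> avoids A e x \<longrightarrow> P (e(v := x)) f = P' e f)"
    using conj.IH(1) by (elim exE conjE)
  obtain B M where B: "finite B" "M > 0" "\<forall>(k, t, g)\<in>B. k \<noteq> 0 \<and> lin t \<and> expsum d g" and
    Q: "\<forall>r. \<exists>P'. bdef d P' \<and>
      (\<forall>e f x. x mod M = r mod M \<longrightarrow> avoids B e x \<longrightarrow> Q (e(v := x)) f = P' e f)"
    using conj.IH(2) by (elim exE conjE)
  have "\<exists>P'. bdef d P' \<and>
      (\<forall>e f x. x mod (N * M) = r mod (N * M) \<longrightarrow> avoids (A \<union> B) e x \<longrightarrow>
        (P (e(v := x)) f \<and> Q (e(v := x)) f) = P' e f)" for r
  proof -
    from P obtain P' where P': "bdef d P'"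
      "\<forall>e f x. x mod N = r mod N \<longrightarrow> avoids A e x \<longrightarrow> P (e(v := x)) f = P' e f" by metis
    from Q obtain Q' where Q': "bdef d Q'"
      "\<forall>e f x. x mod M = r mod M \<longrightarrow> avoids B e x \<longrightarrow> Q (e(v := x)) f = Q' e f" by metis
    show ?thesis
    proof (intro exI[of _ "\<lambda>e f. P' e f \<and> Q' e f"] conjI allI impI bdef.conj P' Q')
      fix e f x assume x: "x mod (N * M) = r mod (N * M)" "avoids (A \<union> B) e x"
      have "N * M dvd x - r" using x(1) by (simp add: mod_eq_dvd_iff)
      then have "N dvd x - r" "M dvd x - r" by (rule dvd_mult_left, rule dvd_mult_right)
      then have "x mod N = r mod N" "x mod M = r mod M" by (simp_all add: mod_eq_dvd_iff)
      moreover have "avoids A e x" "avoids B e x" using x(2) by (auto simp: avoids_def)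
      ultimately show "(P (e(v := x)) f \<and> Q (e(v := x)) f) = (P' e f \<and> Q' e f)"
        using P' Q' by (simp del: fun_upd_apply)
    qed
  qed
  with A B show ?case by (intro exI[of _ "A \<union> B"] exI[of _ "N * M"]) (auto simp del: fun_upd_apply)
next
  case (ex P w)
  then obtain A N where A: "finite A" "N > 0" "\<forall>(k, t, g)\<in>A. k \<noteq> 0 \<and> lin t \<and> expsum d g" and
    P: "\<forall>r. \<exists>P'. bdef d P' \<and>
      (\<forall>e f x. x mod N = r mod N \<longrightarrow> avoids A e x \<longrightarrow> P (e(v := x)) f = P' e f)"
    by (elim exE conjE)
  have "\<exists>P'. bdef d P' \<and>
      (\<forall>e f x. x mod N = r mod N \<longrightarrow> avoids A e x \<longrightarrow> (\<exists>n. P (e(v := x)) (f(w := n))) = P' e f)" for r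
  proof -
    from P obtain P' where "bdef d P'"
      "\<forall>e f x. x mod N = r mod N \<longrightarrow> avoids A e x \<longrightarrow> P (e(v := x)) f = P' e f" by metis
    then show ?thesis by (intro exI[of _ "\<lambda>e f. \<exists>n. P' e (f(w := n))"] conjI bdef.ex) (auto simp del: fun_upd_apply)
  qed
  with A show ?case by (intro exI[of _ A] exI[of _ N]) (auto simp del: fun_upd_apply)
qed

text \<open>Substituting the quotient of \<open>a + b\<close> by \<open>k\<close> for
  \<open>y\<close> in \<open>c * y + s + g\<close> leaves a fraction; multiplied by \<open>k\<close>
  it splits again into a linear form and a sum of powers.\<close>

lemma cleared_denominator:
  fixes a b c k s g y :: int
  assumes "a + b = k * y"
  shows "(c * a + k * s) + (c * b + k * g) = k * (c * y + s + g)"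
proof -
  have "(c * a + k * s) + (c * b + k * g) = c * (a + b) + k * (s + g)"
    by (simp add: algebra_simps)
  then show ?thesis by (simp add: assms algebra_simps)
qed

text \<open>
  To avoid capture, the exponents of the substituted term live at even and those of \<open>P\<close> at odd
  positions.
\<close>

lemma bdef_subst:
  assumes "bdef d P" "lin t0" "expsum d g0" "k > 0"
  shows "bdef d (\<lambda>e f. k dvd t0 e + g0 (\<lambda>i. f (2 * i)) \<and>
    P (e(v := (t0 e + g0 (\<lambda>i. f (2 * i))) div k)) (\<lambda>i. f (2 * i + 1)))"
    (is "bdef d (\<lambda>e f. k dvd ?u e f \<and> P (e(v := ?u e f div k)) (\<lambda>i. f (2 * i + 1)))")
  using assms(1)
proof (induction rule: bdef.induct)
  let ?D = "\<lambda>e f. k dvd ?u e f"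
  have g0: "expsum d (\<lambda>f. g0 (\<lambda>i. f (2 * i)))" by (rule expsum_comp[OF assms(3)])
  have D: "bdef d ?D"
    using bdef.cong[OF assms(2) g0 assms(4), of 0] by (simp add: dvd_eq_mod_eq_0)
  {
    case (eq t g)
    obtain c t' where t': "lin t'" "\<forall>e x. t (e(v := x)) = c * x + t' e"
      using lin_split[OF eq(1), of v] by (elim exE conjE)
    have "lin (\<lambda>e. c * t0 e + k * t' e)"
      by (intro zspan.add zspan.scale assms t')
    moreover have "expsum d (\<lambda>f. c * g0 (\<lambda>i. f (2 * i)) + k * g (\<lambda>i. f (2 * i + 1)))"
      by (intro zspan.add zspan.scale g0 expsum_comp[OF eq(2)])
    ultimately have "bdef d (\<lambda>e f. ?D e f \<and> (c * t0 e + k * t' e) +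
        (c * g0 (\<lambda>i. f (2 * i)) + k * g (\<lambda>i. f (2 * i + 1))) = 0)"
      by (intro bdef.conj[OF D] bdef.eq)
    moreover have "(?D e f \<and> (c * t0 e + k * t' e) +
        (c * g0 (\<lambda>i. f (2 * i)) + k * g (\<lambda>i. f (2 * i + 1))) = 0) =
        (?D e f \<and> t (e(v := ?u e f div k)) + g (\<lambda>i. f (2 * i + 1)) = 0)" for e f
    proof (rule conj_cong[OF refl])
      assume "?D e f"
      then obtain y where y: "?u e f = k * y" unfolding dvd_def by (elim exE)
      have "(c * t0 e + k * t' e) + (c * g0 (\<lambda>i. f (2 * i)) + k * g (\<lambda>i. f (2 * i + 1))) =
          k * (c * y + t' e + g (\<lambda>i. f (2 * i + 1)))" using y by (rule cleared_denominator)
      then show "((c * t0 e + k * t' e) + (c * g0 (\<lambda>i. f (2 * i)) + k * g (\<lambda>i. f (2 * i + 1))) = 0) =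
          (t (e(v := ?u e f div k)) + g (\<lambda>i. f (2 * i + 1)) = 0)"
        using assms(4) t'(2) y by simp
    qed
    ultimately show ?case by (simp only:)
  next
    case (cong t g N r)
    obtain c t' where t': "lin t'" "\<forall>e x. t (e(v := x)) = c * x + t' e"
      using lin_split[OF cong(1), of v] by (elim exE conjE)
    have "lin (\<lambda>e. c * t0 e + k * t' e)"
      by (intro zspan.add zspan.scale assms t')
    moreover have "expsum d (\<lambda>f. c * g0 (\<lambda>i. f (2 * i)) + k * g (\<lambda>i. f (2 * i + 1)))"
      by (intro zspan.add zspan.scale g0 expsum_comp[OF cong(2)])
    moreover have "k * N > 0" using assms(4) cong(3) by simp
    ultimately have "bdef d (\<lambda>e f. ?D e f \<and> ((c * t0 e + k * t' e) +
        (c * g0 (\<lambda>i. f (2 * i)) + k * g (\<lambda>i. f (2 * i + 1)))) mod (k * N) = k * r)"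
      by (intro bdef.conj[OF D] bdef.cong)
    moreover have "(?D e f \<and> ((c * t0 e + k * t' e) +
        (c * g0 (\<lambda>i. f (2 * i)) + k * g (\<lambda>i. f (2 * i + 1)))) mod (k * N) = k * r) =
        (?D e f \<and> (t (e(v := ?u e f div k)) + g (\<lambda>i. f (2 * i + 1))) mod N = r)" for e f
    proof (rule conj_cong[OF refl])
      assume "?D e f"
      then obtain y where y: "?u e f = k * y" unfolding dvd_def by (elim exE)
      have "(c * t0 e + k * t' e) + (c * g0 (\<lambda>i. f (2 * i)) + k * g (\<lambda>i. f (2 * i + 1))) =
          k * (c * y + t' e + g (\<lambda>i. f (2 * i + 1)))" using y by (rule cleared_denominator)
      also have "\<dots> mod (k * N) = k * ((c * y + t' e + g (\<lambda>i. f (2 * i + 1))) mod N)"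
        by (simp only: mult_mod_right)
      finally show "(((c * t0 e + k * t' e) + (c * g0 (\<lambda>i. f (2 * i)) + k * g (\<lambda>i. f (2 * i + 1)))) mod (k * N) = k * r) =
          ((t (e(v := ?u e f div k)) + g (\<lambda>i. f (2 * i + 1))) mod N = r)"
        using assms(4) t'(2) y by simp
    qed
    ultimately show ?case by (simp only:)
  next
    case (pres P)
    show ?case using bdef.pres[OF pres_comp[OF pres]] by (rule bdef.conj[OF D])
  next
    case (neg P)
    \<comment> \<open>Negating the induction hypothesis also negates the divisibility condition,
      which is therefore imposed anew.\<close>
    have "bdef d (\<lambda>e f. ?D e f \<and> \<not> (?D e f \<and> P (e(v := ?u e f div k)) (\<lambda>i. f (2 * i + 1))))"
      by (intro bdef.conj[OF D] bdef.neg neg.IH)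
    moreover have "(?D e f \<and> \<not> (?D e f \<and> P (e(v := ?u e f div k)) (\<lambda>i. f (2 * i + 1)))) =
       (?D e f \<and> \<not> P (e(v := ?u e f div k)) (\<lambda>i. f (2 * i + 1)))" for e f by blast
    ultimately show ?case by (simp only:)
  next
    case (conj P Q)
    have "bdef d (\<lambda>e f. (?D e f \<and> P (e(v := ?u e f div k)) (\<lambda>i. f (2 * i + 1))) \<and>
        (?D e f \<and> Q (e(v := ?u e f div k)) (\<lambda>i. f (2 * i + 1))))"
      by (intro bdef.conj conj.IH)
    moreover have "((?D e f \<and> P (e(v := ?u e f div k)) (\<lambda>i. f (2 * i + 1))) \<and>
        (?D e f \<and> Q (e(v := ?u e f div k)) (\<lambda>i. f (2 * i + 1)))) =
       (?D e f \<and> P (e(v := ?u e f div k)) (\<lambda>i. f (2 * i + 1)) \<and>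
        Q (e(v := ?u e f div k)) (\<lambda>i. f (2 * i + 1)))" for e f by blast
    ultimately show ?case by (simp only:)
  next
    case (ex P w)
    have 1: "(\<lambda>i. (f(2 * w + 1 := n)) (2 * i)) = (\<lambda>i. f (2 * i))"
      "(\<lambda>i. (f(2 * w + 1 := n)) (2 * i + 1)) = (\<lambda>i. f (2 * i + 1))(w := n)"
      for f :: "nat \<Rightarrow> nat" and n
      by (auto simp: fun_eq_iff dest: arg_cong[of _ _ even])
    show ?case using bdef.ex[OF ex.IH, of "2 * w + 1"] unfolding 1 by simp
  }
qed

text \<open>Predicates that come from formulas satisfy \<open>indep\<close>, as formulas have no
  free exponent variables. So the exponents of a substituted term can be quantified without regard
  to the assignment at which \<open>P\<close> is evaluated.\<close>

lemma bdef_ex_int: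
  assumes d: "d > 0" and P: "bdef d P" and indep: "\<And>e f f'. P e f = P e f'"
  shows "\<exists>P''. bdef d P'' \<and> (\<forall>e f. P'' e f = (\<exists>x. P (e(v := x)) f))"
proof -
  obtain A N where A: "finite A" "N > 0" "\<forall>(k, t, g)\<in>A. k \<noteq> 0 \<and> lin t \<and> expsum d g" and
    gen: "\<forall>r. \<exists>P'. bdef d P' \<and>
      (\<forall>e f x. x mod N = r mod N \<longrightarrow> avoids A e x \<longrightarrow> P (e(v := x)) f = P' e f)"
    using bdef_generic[OF P, of v] by (elim exE conjE)
  from choice[OF gen] obtain P' where P': "\<And>r. bdef d (P' r)"
    "\<And>r e f x. x mod N = r mod N \<Longrightarrow> avoids A e x \<Longrightarrow> P (e(v := x)) f = P' r e f" by metis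
  \<comment> \<open>The equation \<open>k * x + t + g = 0\<close> is solved as
    \<open>\<bar>k\<bar> * x = - sgn k * (t + g)\<close>, since \<open>bdef_subst\<close> divides by
    a positive number.\<close>
  define u where "u a e h = - sgn (fst a) * (fst (snd a) e + snd (snd a) h)"
    for a :: "int \<times> ((nat \<Rightarrow> int) \<Rightarrow> int) \<times> ((nat \<Rightarrow> nat) \<Rightarrow> int)" and e h
  define R where "R a e f = (\<bar>fst a\<bar> dvd u a e (\<lambda>i. f (2 * i)) \<and>
      P (e(v := u a e (\<lambda>i. f (2 * i)) div \<bar>fst a\<bar>)) (\<lambda>i. f (2 * i + 1)))" for a e f
  have R: "bdef d (R a)" if "a \<in> A" for a
  proof -
    have a: "fst a \<noteq> 0" "lin (fst (snd a))" "expsum d (snd (snd a))" using A(3) that by auto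
    show ?thesis
      using bdef_subst[OF P zspan.scale[OF a(2), of "- sgn (fst a)"]
          zspan.scale[OF a(3), of "- sgn (fst a)"], of "\<bar>fst a\<bar>" v] a(1)
      unfolding R_def[abs_def] u_def distrib_left by simp
  qed
  have "\<exists>m. \<forall>a\<in>A. \<forall>f f'. (\<forall>i<m a. f i = f' i) \<longrightarrow> snd (snd a) f = snd (snd a) f'"
  proof (intro bchoice ballI)
    fix a assume "a \<in> A"
    then have "expsum d (snd (snd a))" using A(3) by auto
    then show "\<exists>m. \<forall>f f'. (\<forall>i<m. f i = f' i) \<longrightarrow> snd (snd a) f = snd (snd a) f'"
      by (rule expsum_finite_support)
  qed
  then obtain m where m: "\<forall>a\<in>A. \<forall>f f'. (\<forall>i<m a. f i = f' i) \<longrightarrow> snd (snd a) f = snd (snd a) f'" ..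
  \<comment> \<open>The even positions that the sum of powers in \<open>a\<close> actually
    reads.\<close>
  define I where "I a = (\<lambda>i. 2 * i) ` {..<m a}" for a
  define P'' where "P'' e f = ((\<exists>r\<in>{0..<N}. P' r e f) \<or>
      (\<exists>a\<in>A. \<exists>h. R a e (\<lambda>i. if i \<in> I a then h i else f i)))" for e f
  have "bdef d P''" unfolding P''_def[abs_def]
    using A(1) P'(1) R by (intro bdef_disj bdef_bex bdef_ex_finite) (auto simp: I_def)
  moreover have "P'' e f = (\<exists>x. P (e(v := x)) f)" for e f
  proof
    assume "P'' e f"
    then consider r where "r \<in> {0..<N}" "P' r e f" |
      a h where "a \<in> A" "R a e (\<lambda>i. if i \<in> I a then h i else f i)"
      unfolding P''_def by (elim disjE bexE exE)
    then show "\<exists>x. P (e(v := x)) f"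
    proof cases
      case 1
      have "\<exists>x. x mod N = r mod N \<and> avoids A e x"
        using A d by (intro avoiding_element_exists) auto
      then obtain x where "x mod N = r mod N" "avoids A e x" by (elim exE conjE)
      from P'(2)[OF this, of f] 1(2) have "P (e(v := x)) f" by (simp only:)
      then show ?thesis ..
    next
      case 2
      let ?f = "\<lambda>i. if i \<in> I a then h i else f i"
      have "P (e(v := u a e (\<lambda>i. ?f (2 * i)) div \<bar>fst a\<bar>)) (\<lambda>i. ?f (2 * i + 1))"
        using 2(2) unfolding R_def by (rule conjunct2)
      then have "P (e(v := u a e (\<lambda>i. ?f (2 * i)) div \<bar>fst a\<bar>)) f"
        by (rule indep[THEN iffD1])
      then show ?thesis ..
    qed
  next
    assume "\<exists>x. P (e(v := x)) f"
    then obtain x where x: "P (e(v := x)) f" ..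
    show "P'' e f"
    proof (cases "avoids A e x")
      case True
      have "P' (x mod N) e f" using P'(2)[of x "x mod N" e f] True x by (simp del: fun_upd_apply)
      moreover have "x mod N \<in> {0..<N}" using A(2) by simp
      ultimately show ?thesis unfolding P''_def by (intro disjI1 bexI)
    next
      case False
      then obtain a h where a: "a \<in> A" "fst a * x + fst (snd a) e + snd (snd a) h = 0"
        unfolding avoids_def by (auto simp: case_prod_beta)
      define h' where "h' = (\<lambda>i. if i \<in> I a then h (i div 2) else f i)"
      have "snd (snd a) (\<lambda>i. h' (2 * i)) = snd (snd a) h"
        using m a(1) by (auto simp: h'_def I_def)
      then have "fst (snd a) e + snd (snd a) (\<lambda>i. h' (2 * i)) = - fst a * x"
        using a(2) by simp
      then have "u a e (\<lambda>i. h' (2 * i)) = - sgn (fst a) * (- fst a * x)"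
        unfolding u_def by (simp only:)
      also have "\<dots> = \<bar>fst a\<bar> * x" by (simp add: abs_sgn)
      finally have "u a e (\<lambda>i. h' (2 * i)) = \<bar>fst a\<bar> * x" .
      moreover have "fst a \<noteq> 0" using A(3) a(1) by auto
      moreover have "P (e(v := x)) (\<lambda>i. h' (2 * i + 1))" using x by (rule indep[THEN iffD1])
      ultimately have "R a e h'" unfolding R_def by (simp del: fun_upd_apply)
      then show ?thesis unfolding P''_def h'_def using a(1) by (intro disjI2 bexI exI)
    qed
  qed
  ultimately show ?thesis by (intro exI[of _ P''] conjI allI)
qed

section \<open>Translation of formulas into predicates over exponents\<close>

lemma lin_eval_trm: "wf_trm pow_sig t \<Longrightarrow> lin (\<lambda>e. eval_trm (int_pow_struct d) e t)"
proof (induction t)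
  case (Var v)
  have "lin (\<lambda>e. e v)" by (rule zspan.base) simp
  then show ?case by simp
next
  case (App f ts)
  have f: "f = Plus" by (cases f)
  with App.prems have "length ts = 2" by (simp add: pow_sig_def)
  then obtain s t where ts: "ts = [s, t]"
    by (auto simp: length_Suc_conv numeral_2_eq_2)
  with App f have "lin (\<lambda>e. eval_trm (int_pow_struct d) e s)" "lin (\<lambda>e. eval_trm (int_pow_struct d) e t)"
    by auto
  then have "lin (\<lambda>e. eval_trm (int_pow_struct d) e s + eval_trm (int_pow_struct d) e t)"
    by (rule zspan.add)
  then show ?case by (simp add: f ts int_pow_struct_def)
qed

lemma bdef_eq_power: "lin t \<Longrightarrow> bdef d (\<lambda>e f. t e = int d ^ f i)"
proof -
  assume t: "lin t"
  have "expsum d (\<lambda>f. - 1 * int d ^ f i)" by (intro zspan.scale zspan.base) simp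
  from bdef.eq[OF t this] show ?thesis by simp
qed

text \<open>Multiplication of powers becomes addition of exponents. For \<open>d = 1\<close> a power
  does not determine its exponent, but only the existence of exponents is used.\<close>

lemma bdef_sat:
  assumes d: "d > 0"
  shows "wf_fm pow_sig \<phi> \<Longrightarrow> \<exists>P. bdef d P \<and> (\<forall>e f. P e f = sat (int_pow_struct d) e \<phi>)"
proof (induction \<phi>)
  case (Equal s t)
  have "lin (\<lambda>e. eval_trm (int_pow_struct d) e s - eval_trm (int_pow_struct d) e t)"
    using Equal by (intro zspan_diff lin_eval_trm) auto
  moreover have "expsum d (\<lambda>f. 0)" by (rule zspan_zero[OF zspan.base]) auto
  ultimately have "bdef d (\<lambda>e f. eval_trm (int_pow_struct d) e s - eval_trm (int_pow_struct d) e t + 0 = 0)"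
    by (rule bdef.eq)
  then show ?case
    by - (rule exI, erule conjI, simp)
next
  case (Rel r ts)
  show ?case
  proof (cases r)
    case Pow
    with Rel have "length ts = 1" by (simp add: pow_sig_def)
    then obtain t where t: "ts = [t]" by (auto simp: length_Suc_conv)
    with Rel have "lin (\<lambda>e. eval_trm (int_pow_struct d) e t)" by (auto intro: lin_eval_trm)
    then have "bdef d (\<lambda>e f. \<exists>n. eval_trm (int_pow_struct d) e t = int d ^ (f(0 := n)) 0)"
      by (intro bdef.ex[where v = 0] bdef_eq_power)
    then show ?thesis
      by - (rule exI, erule conjI, simp add: Pow t int_pow_struct_def powers_def)
  next
    case PowMult
    with Rel have "length ts = 3" by (simp add: pow_sig_def)
    then obtain s t u where ts: "ts = [s, t, u]"
      by (auto simp: length_Suc_conv numeral_3_eq_3)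
    define T where "T v e = eval_trm (int_pow_struct d) e v" for v e
    have lin: "lin (T s)" "lin (T t)" "lin (T u)"
      using Rel ts by (auto simp: T_def[abs_def] intro: lin_eval_trm)
    have "pres (\<lambda>f. int (f 0) + int (f 1) - int (f 2) = 0)"
      by (intro pres_eq0 zspan_diff zspan.add aff_var)
    then have "bdef d (\<lambda>e f. int (f 0) + int (f 1) - int (f 2) = 0)" by (rule bdef.pres)
    then have "bdef d (\<lambda>e f. int (f 0) + int (f 1) - int (f 2) = 0 \<and>
        T s e = int d ^ f 0 \<and> T t e = int d ^ f 1 \<and> T u e = int d ^ f 2)"
      using lin by (intro bdef.conj bdef_eq_power)
    from bdef.ex[OF bdef.ex[OF bdef.ex[OF this, of 2], of 1], of 0]
    have "bdef d (\<lambda>e f. \<exists>i j k. int i + int j - int k = 0 \<and>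
        T s e = int d ^ i \<and> T t e = int d ^ j \<and> T u e = int d ^ k)" by simp
    moreover have "(\<exists>i j k. int i + int j - int k = 0 \<and> x = int d ^ i \<and> y = int d ^ j \<and> z = int d ^ k)
        \<longleftrightarrow> x \<in> powers d \<and> y \<in> powers d \<and> z \<in> powers d \<and> x * y = z" for x y z
    proof
      assume "\<exists>i j k. int i + int j - int k = 0 \<and> x = int d ^ i \<and> y = int d ^ j \<and> z = int d ^ k"
      then obtain i j k where k: "int i + int j - int k = 0"
        and xyz: "x = int d ^ i" "y = int d ^ j" "z = int d ^ k" by blast
      from k have "k = i + j" by linarith
      then have "x * y = z" using xyz by (simp add: power_add)
      moreover have "x \<in> powers d" "y \<in> powers d" "z \<in> powers d"
        using xyz by (auto simp: powers_def)
      ultimately show "x \<in> powers d \<and> y \<in> powers d \<and> z \<in> powers d \<and> x * y = z" by simp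
    next
      assume "x \<in> powers d \<and> y \<in> powers d \<and> z \<in> powers d \<and> x * y = z"
      then obtain i j where "x = int d ^ i" "y = int d ^ j" "z = int d ^ (i + j)"
        by (auto simp: powers_def power_add)
      then show "\<exists>i j k. int i + int j - int k = 0 \<and> x = int d ^ i \<and> y = int d ^ j \<and> z = int d ^ k"
        by (intro exI[of _ i] exI[of _ j] exI[of _ "i + j"]) simp
    qed
    ultimately have "bdef d (\<lambda>e f. T s e \<in> powers d \<and> T t e \<in> powers d \<and> T u e \<in> powers d \<and>
        T s e * T t e = T u e)" by simp
    then show ?thesis
      by - (rule exI, erule conjI, simp add: PowMult ts int_pow_struct_def T_def)
  qed
next
  case (Neg \<phi>)
  then obtain P where "bdef d P" "\<forall>e f. P e f = sat (int_pow_struct d) e \<phi>" by auto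
  then show ?case by (intro exI[of _ "\<lambda>e f. \<not> P e f"] conjI bdef.neg) (assumption | simp)+
next
  case (Conj \<phi> \<psi>)
  then obtain P Q where "bdef d P" "\<forall>e f. P e f = sat (int_pow_struct d) e \<phi>"
    "bdef d Q" "\<forall>e f. Q e f = sat (int_pow_struct d) e \<psi>" by auto
  then show ?case by (intro exI[of _ "\<lambda>e f. P e f \<and> Q e f"] conjI bdef.conj) (assumption | simp)+
next
  case (Exists v \<phi>)
  then obtain P where P: "bdef d P" "\<forall>e f. P e f = sat (int_pow_struct d) e \<phi>" by auto
  from d P(1) have "\<exists>P''. bdef d P'' \<and> (\<forall>e f. P'' e f = (\<exists>x. P (e(v := x)) f))"
    by (rule bdef_ex_int) (simp add: P(2))
  then show ?case by (simp add: P(2))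
qed

section \<open>Reduction to Presburger predicates in the exponents presenting the parameters\<close>

definition merge :: "(nat \<Rightarrow> nat) \<Rightarrow> (nat \<Rightarrow> nat) \<Rightarrow> nat \<Rightarrow> nat" where
  "merge h f = (\<lambda>i. if even i then h (i div 2) else f (i div 2))"

lemma merge_even [simp]: "(\<lambda>i. merge h f (2 * i)) = h"
  by (simp add: merge_def)

lemma merge_odd [simp]: "(\<lambda>i. merge h f (2 * i + 1)) = f"
  by (simp add: merge_def)

text \<open>A quantified exponent variable stays at an odd position, so binding it leaves the
  exponents that describe \<open>e\<close> untouched.\<close>

lemma merge_upd: "(merge h f)(2 * v + 1 := n) = merge h (f(v := n))"
  by (auto simp: merge_def fun_eq_iff elim!: oddE)

text \<open>
  The linear forms of the atoms in \<open>F\<close> are given by the exponents \<open>h\<close>, the other atoms are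
  unsatisfiable whatever the exponents are, and \<open>\<rho>\<close> collects the relevant residues.  Under such
  a presentation \<open>e\<close> enters a predicate only through \<open>h\<close>.
\<close>

definition presents ::
    "(((nat \<Rightarrow> int) \<Rightarrow> int) \<times> ((nat \<Rightarrow> nat) \<Rightarrow> int)) set \<Rightarrow> (((nat \<Rightarrow> int) \<Rightarrow> int) \<times> int) set \<Rightarrow>
     (((nat \<Rightarrow> int) \<Rightarrow> int) \<times> ((nat \<Rightarrow> nat) \<Rightarrow> int)) set \<Rightarrow>
     (((nat \<Rightarrow> int) \<Rightarrow> int) \<times> ((nat \<Rightarrow> nat) \<Rightarrow> int) \<Rightarrow> (nat \<Rightarrow> nat) \<Rightarrow> int) \<Rightarrow>
     (((nat \<Rightarrow> int) \<Rightarrow> int) \<times> int \<Rightarrow> int) \<Rightarrow> (nat \<Rightarrow> int) \<Rightarrow> (nat \<Rightarrow> nat) \<Rightarrow> bool" where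
  "presents A C F G \<rho> e h \<longleftrightarrow>
     (\<forall>a\<in>A. if a \<in> F then fst a e = G a h else \<forall>f. fst a e + snd a f \<noteq> 0) \<and>
     (\<forall>c\<in>C. fst c e mod snd c = \<rho> c)"

lemma presents_mono: "presents A C F G \<rho> e h \<Longrightarrow> B \<subseteq> A \<Longrightarrow> D \<subseteq> C \<Longrightarrow> presents B D F G \<rho> e h"
  unfolding presents_def by (meson subsetD)

text \<open>Under a presentation an atom \<open>t + g = 0\<close> becomes the vanishing sum
  \<open>G + g = 0\<close> or is false for all exponents, so \<open>pres_ex\<close> applies to the
  quantifiers. The sets \<open>A\<close> and \<open>C\<close> come before \<open>F\<close>,
  \<open>G\<close> and \<open>\<rho>\<close>; thus for a fixed \<open>G\<close> finitely many
  \<open>Q\<close> suffice.\<close>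

lemma bdef_pres:
  assumes "bdef d P" "d > 0"
  shows "\<exists>A C. finite A \<and> finite C \<and> (\<forall>a\<in>A. lin (fst a) \<and> expsum d (snd a)) \<and>
    (\<forall>c\<in>C. lin (fst c) \<and> snd c > 0) \<and>
    (\<forall>F G \<rho>. (\<forall>a\<in>A. expsum d (G a)) \<longrightarrow> (\<exists>Q. pres Q \<and>
      (\<forall>e h f. presents A C F G \<rho> e h \<longrightarrow> P e f = Q (merge h f))))"
  using assms(1)
proof (induction rule: bdef.induct)
  case (eq t g)
  have "\<exists>Q. pres Q \<and> (\<forall>e h f. presents {(t, g)} {} F G \<rho> e h \<longrightarrow> (t e + g f = 0) = Q (merge h f))"
    if G: "\<forall>a\<in>{(t, g)}. expsum d (G a)" for F G \<rho>
  proof (cases "(t, g) \<in> F")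
    case True
    have "expsum d (G (t, g))" using G by simp
    from pres_expsum_eq0[OF zspan.add[OF expsum_comp[OF this] expsum_comp[OF eq(2)]] assms(2)]
    have "pres (\<lambda>m. G (t, g) (\<lambda>i. m (2 * i)) + g (\<lambda>i. m (2 * i + 1)) = 0)" .
    moreover have "(t e + g f = 0) = (G (t, g) (\<lambda>i. merge h f (2 * i)) +
        g (\<lambda>i. merge h f (2 * i + 1)) = 0)" if "presents {(t, g)} {} F G \<rho> e h" for e h f
    proof -
      have "t e = G (t, g) h" using that True by (simp add: presents_def)
      then show ?thesis unfolding merge_even merge_odd by (simp only:)
    qed
    ultimately show ?thesis by - (rule exI, erule conjI, intro allI impI)
  next
    case False
    then show ?thesis
      by (intro exI[of _ "\<lambda>m. False"] conjI pres_const) (auto simp: presents_def)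
  qed
  with eq show ?case by (intro exI[of _ "{(t, g)}"] exI[of _ "{}"]) simp
next
  case (cong t g N r)
  have "\<exists>Q. pres Q \<and> (\<forall>e h f. presents {} {(t, N)} F G \<rho> e h \<longrightarrow> ((t e + g f) mod N = r) = Q (merge h f))"
    for F G \<rho>
  proof (intro exI conjI allI impI)
    show "pres (\<lambda>m. r mod N = r \<and> g (\<lambda>i. m (2 * i + 1)) mod N = (r - \<rho> (t, N)) mod N)"
      by (rule pres_conj[OF pres_const pres_expsum_mod[OF expsum_comp[OF cong(2)] cong(3)]])
    fix e h f assume "presents {} {(t, N)} F G \<rho> e h"
    then have "\<rho> (t, N) = t e mod N" by (simp add: presents_def)
    then have "(g f mod N = (r - \<rho> (t, N)) mod N) = ((t e + g f) mod N = r mod N)"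
      by (simp add: mod_diff_right_eq mod_eq_dvd_iff algebra_simps)
    then show "((t e + g f) mod N = r) = (r mod N = r \<and>
        g (\<lambda>i. merge h f (2 * i + 1)) mod N = (r - \<rho> (t, N)) mod N)"
      unfolding merge_odd by auto
  qed
  with cong show ?case by (intro exI[of _ "{}"] exI[of _ "{(t, N)}"]) simp
next
  case (pres P)
  have "\<exists>Q. pres Q \<and> (\<forall>e h f. presents {} {} F G \<rho> e h \<longrightarrow> P f = Q (merge h f))" for F G \<rho>
    by (intro exI[of _ "\<lambda>m. P (\<lambda>i. m (2 * i + 1))"] conjI allI impI pres_comp[OF pres])
       (simp only: merge_odd)
  then show ?case by (intro exI[of _ "{}"] conjI) simp_all
next
  case (neg P)
  then obtain A C where AC: "finite A" "finite C" "\<forall>a\<in>A. lin (fst a) \<and> expsum d (snd a)"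
    "\<forall>c\<in>C. lin (fst c) \<and> snd c > 0" and
    Q: "\<forall>F G \<rho>. (\<forall>a\<in>A. expsum d (G a)) \<longrightarrow> (\<exists>Q. pres Q \<and>
      (\<forall>e h f. presents A C F G \<rho> e h \<longrightarrow> P e f = Q (merge h f)))"
    by (elim exE conjE)
  have "\<exists>Q. pres Q \<and> (\<forall>e h f. presents A C F G \<rho> e h \<longrightarrow> (\<not> P e f) = Q (merge h f))"
    if "\<forall>a\<in>A. expsum d (G a)" for F G \<rho>
  proof -
    from Q that obtain Q' where "pres Q'" "\<forall>e h f. presents A C F G \<rho> e h \<longrightarrow> P e f = Q' (merge h f)"
      by metis
    then show ?thesis by (intro exI[of _ "\<lambda>m. \<not> Q' m"] conjI pres_not) (assumption | simp)+
  qed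
  with AC show ?case by (intro exI[of _ A] exI[of _ C]) simp
next
  case (conj P P')
  obtain A C where AC: "finite A" "finite C" "\<forall>a\<in>A. lin (fst a) \<and> expsum d (snd a)"
    "\<forall>c\<in>C. lin (fst c) \<and> snd c > 0" and
    Q: "\<forall>F G \<rho>. (\<forall>a\<in>A. expsum d (G a)) \<longrightarrow> (\<exists>Q. pres Q \<and>
      (\<forall>e h f. presents A C F G \<rho> e h \<longrightarrow> P e f = Q (merge h f)))"
    using conj.IH(1) by (elim exE conjE)
  obtain B D where BD: "finite B" "finite D" "\<forall>a\<in>B. lin (fst a) \<and> expsum d (snd a)"
    "\<forall>c\<in>D. lin (fst c) \<and> snd c > 0" and
    Q': "\<forall>F G \<rho>. (\<forall>a\<in>B. expsum d (G a)) \<longrightarrow> (\<exists>Q. pres Q \<and>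
      (\<forall>e h f. presents B D F G \<rho> e h \<longrightarrow> P' e f = Q (merge h f)))"
    using conj.IH(2) by (elim exE conjE)
  have "\<exists>Q. pres Q \<and> (\<forall>e h f. presents (A \<union> B) (C \<union> D) F G \<rho> e h \<longrightarrow>
      (P e f \<and> P' e f) = Q (merge h f))"
    if "\<forall>a\<in>A \<union> B. expsum d (G a)" for F G \<rho>
  proof -
    from Q that obtain R where R: "pres R" "\<forall>e h f. presents A C F G \<rho> e h \<longrightarrow> P e f = R (merge h f)"
      by (metis UnI1)
    from Q' that obtain R' where R': "pres R'" "\<forall>e h f. presents B D F G \<rho> e h \<longrightarrow> P' e f = R' (merge h f)"
      by (metis UnI2)
    show ?thesis
    proof (intro exI[of _ "\<lambda>m. R m \<and> R' m"] conjI allI impI pres_conj R R')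
      fix e h f assume *: "presents (A \<union> B) (C \<union> D) F G \<rho> e h"
      have "presents A C F G \<rho> e h" "presents B D F G \<rho> e h"
        by (rule presents_mono[OF *]; blast)+
      then show "(P e f \<and> P' e f) = (R (merge h f) \<and> R' (merge h f))" using R R' by simp
    qed
  qed
  with AC BD show ?case by (intro exI[of _ "A \<union> B"] exI[of _ "C \<union> D"]) auto
next
  case (ex P v)
  then obtain A C where AC: "finite A" "finite C" "\<forall>a\<in>A. lin (fst a) \<and> expsum d (snd a)"
    "\<forall>c\<in>C. lin (fst c) \<and> snd c > 0" and
    Q: "\<forall>F G \<rho>. (\<forall>a\<in>A. expsum d (G a)) \<longrightarrow> (\<exists>Q. pres Q \<and>
      (\<forall>e h f. presents A C F G \<rho> e h \<longrightarrow> P e f = Q (merge h f)))"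
    by (elim exE conjE)
  have "\<exists>Q. pres Q \<and> (\<forall>e h f. presents A C F G \<rho> e h \<longrightarrow> (\<exists>n. P e (f(v := n))) = Q (merge h f))"
    if "\<forall>a\<in>A. expsum d (G a)" for F G \<rho>
  proof -
    from Q that obtain Q' where "pres Q'" "\<forall>e h f. presents A C F G \<rho> e h \<longrightarrow> P e f = Q' (merge h f)"
      by metis
    then show ?thesis
      by (intro exI[of _ "\<lambda>m. \<exists>n. Q' (m(2 * v + 1 := n))"] conjI pres_ex)
         (assumption, simp only: merge_upd, simp)
  qed
  with AC show ?case by (intro exI[of _ A] exI[of _ C]) simp
qed

section \<open>Counting\<close>

text \<open>The sets grow with the shift, and a member of a chain of finite sets is determined by
  its cardinality.\<close>

lemma shifted_positive_eq:
  fixes u :: "'a \<Rightarrow> int"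
  assumes "finite S" "card {i \<in> S. u i + v > 0} = card {i \<in> S. u i + v' > 0}" "i \<in> S"
  shows "u i + v > 0 \<longleftrightarrow> u i + v' > 0"
proof -
  have *: "{i \<in> S. u i + w > 0} = {i \<in> S. u i + w' > 0}"
    if "w \<le> w'" "card {i \<in> S. u i + w > 0} = card {i \<in> S. u i + w' > 0}" for w w'
    using assms(1) that by (intro card_subset_eq) auto
  have "{i \<in> S. u i + v > 0} = {i \<in> S. u i + v' > 0}"
  proof (cases "v \<le> v'")
    case True
    then show ?thesis using assms(2) by (rule *)
  next
    case False
    then show ?thesis using *[of v' v] assms(2) by simp
  qed
  with assms(3) show ?thesis by blast
qed

lemma card_PiE_atMost: "finite S \<Longrightarrow> card (PiE S (\<lambda>_. {..K})) = Suc K ^ card S" for K :: nat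
  by (simp add: card_PiE)

text \<open>
  The code of \<open>b\<close> consists, for every atom \<open>t + g = 0\<close>, of an index \<open>i\<close> at which it is
  satisfiable (or \<open>n\<close> if there is none), of residues, and of the numbers of indices \<open>i\<close> at which the
  affine forms of the Presburger predicate are positive or nonnegative.  As \<open>b\<close> contributes a
  summand independent of \<open>i\<close>, the latter numbers determine the sets of these indices.
\<close>

lemma bdef_few_cuts:
  assumes P: "bdef d P" and d: "d > 0"
  shows "\<exists>c k. \<forall>n a B. finite B \<longrightarrow>
    (\<forall>b\<in>B. \<forall>b'\<in>B. (\<forall>i<n. P (override_on b (a i) X) f = P (override_on b' (a i) X) f) \<longrightarrow> b = b') \<longrightarrow>
    card B \<le> (n + c) ^ k"
proof -
  obtain A C where AC: "finite A" "finite C" "\<forall>a\<in>A. lin (fst a) \<and> expsum d (snd a)"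
    "\<forall>c\<in>C. lin (fst c) \<and> snd c > 0" and
    ex_Q: "\<forall>F G \<rho>. (\<forall>a\<in>A. expsum d (G a)) \<longrightarrow> (\<exists>Q. pres Q \<and>
      (\<forall>e h f. presents A C F G \<rho> e h \<longrightarrow> P e f = Q (merge h f)))"
    using bdef_pres[OF P d] by (elim exE conjE)
  obtain idx :: "_ \<Rightarrow> nat" where idx: "inj_on idx A"
    using finite_imp_inj_to_nat_seg[OF AC(1)] by blast
  \<comment> \<open>Each atom owns three disjoint blocks of exponents: two for a pair linking the
    indices \<open>i\<close> and \<open>\<delta> b x\<close>, and one for a solution at
    \<open>\<delta> b x\<close>.\<close>
  define part where "part x j h = (\<lambda>l. h (prod_encode (3 * idx x + j, l)))"
    for x and j and h :: "nat \<Rightarrow> nat"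
  \<comment> \<open>With \<open>j = \<delta> b x\<close>, the value at \<open>i\<close> is the value
    at \<open>j\<close>, which is minus a sum of powers, plus the difference of the contributions of
    \<open>a\<close> at \<open>i\<close> and \<open>j\<close>, which is a difference of two such
    sums.\<close>
  define G where "G x h = snd x (part x 0 h) - snd x (part x 1 h) - snd x (part x 2 h)" for x h
  have G: "\<forall>a\<in>A. expsum d (G a)"
  proof
    fix x assume "x \<in> A"
    then have "expsum d (snd x)" using AC(3) by simp
    then show "expsum d (G x)" unfolding G_def[abs_def] part_def
      by (intro zspan_diff) (erule expsum_comp)+
  qed
  have "\<forall>y. \<exists>Q. pres Q \<and> (\<forall>e h f. presents A C (fst y) G (snd y) e h \<longrightarrow> P e f = Q (merge h f))"
    using ex_Q G by simp
  from choice[OF this] obtain Q where Q': "\<forall>y. pres (Q y) \<and>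
    (\<forall>e h f. presents A C (fst y) G (snd y) e h \<longrightarrow> P e f = Q y (merge h f))" ..
  have Q: "pres (Q y)" "presents A C (fst y) G (snd y) e h \<Longrightarrow> P e f = Q y (merge h f)" for y e h f
    using Q'[THEN spec, of y] by simp_all
  \<comment> \<open>The possible pairs of \<open>F\<close> and \<open>\<rho>\<close> form a finite
    set independent of \<open>n\<close>, \<open>a\<close> and \<open>B\<close>, so \<open>T\<close>
    and \<open>N\<close> can be fixed before these.\<close>
  define Y where "Y = Set.Pow A \<times> PiE C (\<lambda>c. {0..<snd c})"
  have "finite Y" using AC unfolding Y_def by (intro finite_cartesian_product finite_PiE) auto
  then have "\<exists>T N. finite T \<and> (\<forall>t\<in>T. aff t) \<and> N > 0 \<and>
    (\<forall>R\<in>Q ` Y. \<forall>f f'. agree T N f f' \<longrightarrow> R f = R f')"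
    using Q(1) by (intro pres_family) auto
  then obtain T N where T: "finite T" "\<forall>t\<in>T. aff t" "N > 0" and
    det: "\<forall>R\<in>Q ` Y. \<forall>f f'. agree T N f f' \<longrightarrow> R f = R f'" by (elim exE conjE)
  \<comment> \<open>\<open>n + c\<close> bounds the number of values of each component of the code,
    and \<open>k\<close> counts the components: one per atom, one per congruence and three per
    affine form.\<close>
  define c where "c = Suc (nat N + (\<Sum>c\<in>C. nat (snd c)))"
  define k where "k = card A + (card C + (card T + (card T + card T)))"
  show ?thesis
  proof (rule exI[of _ c], rule exI[of _ k], intro allI impI)
    fix n :: nat and a :: "nat \<Rightarrow> nat \<Rightarrow> int" and B
    assume finB: "finite B" and distinct:
      "\<forall>b\<in>B. \<forall>b'\<in>B. (\<forall>i<n. P (override_on b (a i) X) f = P (override_on b' (a i) X) f) \<longrightarrow> b = b'"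
    define e where "e i b = override_on b (a i) X" for i b
    define \<alpha> where "\<alpha> t i = t (override_on (\<lambda>_. 0) (a i) X)" for t :: "(nat \<Rightarrow> int) \<Rightarrow> int" and i
    define \<beta> where "\<beta> t b = t (override_on b (\<lambda>_. 0) X)" for t :: "(nat \<Rightarrow> int) \<Rightarrow> int" and b
    have \<alpha>\<beta>: "t (e i b) = \<alpha> t i + \<beta> t b" if "lin t" for t i b
    proof -
      have "e i b = (\<lambda>v. override_on (\<lambda>_. 0) (a i) X v + override_on b (\<lambda>_. 0) X v)"
        by (auto simp: e_def override_on_def)
      then show ?thesis using lin_add[OF that] by (simp add: \<alpha>_def \<beta>_def)
    qed
    define hits where "hits b x i \<longleftrightarrow> i < n \<and> (\<exists>h. fst x (e i b) + snd x h = 0)"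
      for b i and x :: "((nat \<Rightarrow> int) \<Rightarrow> int) \<times> ((nat \<Rightarrow> nat) \<Rightarrow> int)"
    define \<delta> where "\<delta> b = restrict (\<lambda>x. if \<exists>i. hits b x i then SOME i. hits b x i else n) A" for b
    \<comment> \<open>Satisfiability of the atom at both \<open>i\<close> and \<open>j\<close> for
      one \<open>b\<close> forces this relation, in which \<open>b\<close> does not occur. Hence
      \<open>F\<close> depends on \<open>b\<close> only through \<open>\<delta> b\<close>. At a
      linked index the atom is presented by exponents even if it is not satisfiable there.\<close>
    define linked where "linked x i j \<longleftrightarrow> (\<exists>p. \<alpha> (fst x) i - \<alpha> (fst x) j = snd x (fst p) - snd x (snd p))"
      for x :: "((nat \<Rightarrow> int) \<Rightarrow> int) \<times> ((nat \<Rightarrow> nat) \<Rightarrow> int)" and i j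
    define pp where "pp x i j = (SOME p. \<alpha> (fst x) i - \<alpha> (fst x) j = snd x (fst p) - snd x (snd p))"
      for x :: "((nat \<Rightarrow> int) \<Rightarrow> int) \<times> ((nat \<Rightarrow> nat) \<Rightarrow> int)" and i j
    define h0 where "h0 b x = (SOME h. fst x (e (\<delta> b x) b) + snd x h = 0)" for b x
    define F where "F D i = {x \<in> A. D x < n \<and> linked x i (D x)}" for D i
    define ix where "ix c = inv_into A idx (c div 3)" for c
    \<comment> \<open>\<open>H1\<close> depends on \<open>b\<close> only through \<open>D\<close>,
      and \<open>H2\<close> does not depend on \<open>i\<close>. They live on disjoint blocks, so
      their sum stores both.\<close>
    define H1 where "H1 D i w = (case prod_decode w of (c, l) \<Rightarrow>
      if c mod 3 = 0 then fst (pp (ix c) i (D (ix c))) l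
      else if c mod 3 = 1 then snd (pp (ix c) i (D (ix c))) l else 0)" for D i w
    define H2 where "H2 b w = (case prod_decode w of (c, l) \<Rightarrow>
      if c mod 3 = 2 then h0 b (ix c) l else 0)" for b w
    define H where "H D i b w = H1 D i w + H2 b w" for D i b w
    define \<rho> where "\<rho> i b = restrict (\<lambda>c. fst c (e i b) mod snd c) C" for i b
    have parts: "part x 0 (H D i b) = fst (pp x i (D x))" "part x 1 (H D i b) = snd (pp x i (D x))"
      "part x 2 (H D i b) = h0 b x" if "x \<in> A" for x D i b
    proof -
      have ix: "ix (3 * idx x + j) = x" "(3 * idx x + j) mod 3 = j" if "j < 3" for j
        using idx \<open>x \<in> A\<close> that by (auto simp: ix_def)
      show "part x 0 (H D i b) = fst (pp x i (D x))" "part x 1 (H D i b) = snd (pp x i (D x))"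
        "part x 2 (H D i b) = h0 b x"
        using ix[of 0] ix[of 1] ix[of 2] by (simp_all add: part_def H_def H1_def H2_def)
    qed
    have pres: "presents A C (F (\<delta> b) i) G (\<rho> i b) (e i b) (H (\<delta> b) i b)" if i: "i < n" for b i
      unfolding presents_def
    proof (intro conjI ballI)
      fix x assume x: "x \<in> A"
      then have ab: "fst x (e i b) = \<alpha> (fst x) i + \<beta> (fst x) b" for i using AC(3) by (intro \<alpha>\<beta>) simp
      have hit: "fst x (e (\<delta> b x) b) + snd x (h0 b x) = 0" if "\<delta> b x < n"
      proof -
        have "\<exists>i. hits b x i" using that x by (auto simp: \<delta>_def split: if_splits)
        then have "hits b x (\<delta> b x)" using x by (simp add: \<delta>_def someI_ex)
        then have "\<exists>h. fst x (e (\<delta> b x) b) + snd x h = 0" by (simp add: hits_def)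
        then show ?thesis unfolding h0_def by (rule someI_ex)
      qed
      show "if x \<in> F (\<delta> b) i then fst x (e i b) = G x (H (\<delta> b) i b)
          else \<forall>f. fst x (e i b) + snd x f \<noteq> 0"
      proof (cases "x \<in> F (\<delta> b) i")
        case True
        then have "\<delta> b x < n" "linked x i (\<delta> b x)" by (auto simp: F_def)
        from this(2) have "\<alpha> (fst x) i - \<alpha> (fst x) (\<delta> b x) =
            snd x (fst (pp x i (\<delta> b x))) - snd x (snd (pp x i (\<delta> b x)))"
          unfolding linked_def pp_def by (rule someI_ex)
        with hit[OF \<open>\<delta> b x < n\<close>] have "fst x (e i b) = G x (H (\<delta> b) i b)"
          unfolding G_def parts[OF x] ab by linarith
        with True show ?thesis by simp
      next
        case False
        have "fst x (e i b) + snd x h \<noteq> 0" for h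
        proof
          assume h: "fst x (e i b) + snd x h = 0"
          then have "hits b x i" using i by (auto simp: hits_def)
          then have ex: "\<exists>i. hits b x i" ..
          then have "hits b x (\<delta> b x)" using x by (simp add: \<delta>_def someI_ex)
          then have "\<delta> b x < n" by (simp add: hits_def)
          with hit h have "\<alpha> (fst x) i - \<alpha> (fst x) (\<delta> b x) = snd x (h0 b x) - snd x h"
            unfolding ab by linarith
          then have "linked x i (\<delta> b x)" unfolding linked_def by (intro exI[of _ "(h0 b x, h)"]) simp
          with \<open>\<delta> b x < n\<close> x False show False by (simp add: F_def)
        qed
        with False show ?thesis by simp
      qed
    qed (simp add: \<rho>_def)
    have PQ: "P (e i b) f = Q (F (\<delta> b) i, \<rho> i b) (merge (H (\<delta> b) i b) f)" if "i < n" for i b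
      using pres[OF that] by (intro Q(2)) simp
    have inY: "(F D i, \<rho> i b) \<in> Y" for D i b
      using AC(4) by (auto simp: Y_def F_def \<rho>_def PiE_def Pi_def)
    \<comment> \<open>The constant term is subtracted here because it is counted in
      \<open>w\<close>.\<close>
    define u where "u t D i = t (merge (H1 D i) f) - t (\<lambda>_. 0)"
      for t :: "(nat \<Rightarrow> nat) \<Rightarrow> int" and D i
    define w where "w t b = t (merge (H2 b) (\<lambda>_. 0))" for t :: "(nat \<Rightarrow> nat) \<Rightarrow> int" and b
    have uw: "t (merge (H D i b) f) = u t D i + w t b" if "t \<in> T" for t D i b
    proof -
      have "merge (H D i b) f = (\<lambda>l. merge (H1 D i) f l + merge (H2 b) (\<lambda>_. 0) l)"
        by (auto simp: merge_def H_def)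
      then show ?thesis using T(2) that by (simp add: aff_add u_def w_def)
    qed
    \<comment> \<open>Over the integers \<open>u + (w + 1) > 0\<close> says that
      \<open>u + w\<close> is nonnegative, so the last two counts together determine signs.\<close>
    define code where "code b = (\<delta> b, restrict (\<lambda>c. nat (\<beta> (fst c) b mod snd c)) C,
      restrict (\<lambda>t. nat (w t b mod N)) T,
      restrict (\<lambda>t. card {i \<in> {..<n}. u t (\<delta> b) i + w t b > 0}) T,
      restrict (\<lambda>t. card {i \<in> {..<n}. u t (\<delta> b) i + (w t b + 1) > 0}) T)" for b
    have "inj_on code B"
    proof (rule inj_onI)
      fix b b' assume b: "b \<in> B" "b' \<in> B" and eq: "code b = code b'"
      have D: "\<delta> b' = \<delta> b" using eq by (simp add: code_def)
      have \<beta>: "\<beta> (fst c) b mod snd c = \<beta> (fst c) b' mod snd c" if c: "c \<in> C" for c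
      proof -
        have "restrict (\<lambda>c. nat (\<beta> (fst c) b mod snd c)) C c = restrict (\<lambda>c. nat (\<beta> (fst c) b' mod snd c)) C c"
          using eq by (simp add: code_def)
        moreover have "snd c > 0" using AC(4) c by simp
        ultimately show ?thesis using c by (simp add: nat_eq_iff)
      qed
      have w: "w t b mod N = w t b' mod N"
        "card {i \<in> {..<n}. u t (\<delta> b) i + w t b > 0} = card {i \<in> {..<n}. u t (\<delta> b) i + w t b' > 0}"
        "card {i \<in> {..<n}. u t (\<delta> b) i + (w t b + 1) > 0} =
          card {i \<in> {..<n}. u t (\<delta> b) i + (w t b' + 1) > 0}" if t: "t \<in> T" for t
      proof -
        have "restrict (\<lambda>t. nat (w t b mod N)) T t = restrict (\<lambda>t. nat (w t b' mod N)) T t"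
          using eq by (simp add: code_def)
        then show "w t b mod N = w t b' mod N" using t T(3) by (simp add: nat_eq_iff)
        have "restrict (\<lambda>t. card {i \<in> {..<n}. u t (\<delta> b) i + w t b > 0}) T t =
            restrict (\<lambda>t. card {i \<in> {..<n}. u t (\<delta> b) i + w t b' > 0}) T t"
          using eq unfolding code_def D prod.inject by (elim conjE) (rule fun_cong[where x = t], assumption)
        then show "card {i \<in> {..<n}. u t (\<delta> b) i + w t b > 0} = card {i \<in> {..<n}. u t (\<delta> b) i + w t b' > 0}"
          unfolding restrict_apply using t by (simp only: if_True)
        have "restrict (\<lambda>t. card {i \<in> {..<n}. u t (\<delta> b) i + (w t b + 1) > 0}) T t =
            restrict (\<lambda>t. card {i \<in> {..<n}. u t (\<delta> b) i + (w t b' + 1) > 0}) T t"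
          using eq unfolding code_def D prod.inject by (elim conjE) (rule fun_cong[where x = t], assumption)
        then show "card {i \<in> {..<n}. u t (\<delta> b) i + (w t b + 1) > 0} =
            card {i \<in> {..<n}. u t (\<delta> b) i + (w t b' + 1) > 0}"
          unfolding restrict_apply using t by (simp only: if_True)
      qed
      have "P (e i b) f = P (e i b') f" if i: "i < n" for i
      proof -
        have \<rho>: "\<rho> i b' = \<rho> i b" unfolding \<rho>_def
        proof (rule restrict_ext)
          fix c assume c: "c \<in> C"
          then have "lin (fst c)" using AC(4) by simp
          then show "fst c (e i b') mod snd c = fst c (e i b) mod snd c"
            by (simp only: \<alpha>\<beta>) (rule mod_add_cong[OF refl \<beta>[OF c, symmetric]])
        qed
        have "agree T N (merge (H (\<delta> b) i b) f) (merge (H (\<delta> b) i b') f)"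
          unfolding agree_def
        proof (intro ballI conjI)
          fix t assume t: "t \<in> T"
          have "u t (\<delta> b) i + w t b > 0 \<longleftrightarrow> u t (\<delta> b) i + w t b' > 0"
            using i by (intro shifted_positive_eq[OF _ w(2)[OF t]]) auto
          moreover have "u t (\<delta> b) i + (w t b + 1) > 0 \<longleftrightarrow> u t (\<delta> b) i + (w t b' + 1) > 0"
            using i by (intro shifted_positive_eq[OF _ w(3)[OF t]]) auto
          ultimately have "sgn (u t (\<delta> b) i + w t b) = sgn (u t (\<delta> b) i + w t b')"
            unfolding sgn_if by (smt (verit))
          then show "sgn (t (merge (H (\<delta> b) i b) f)) = sgn (t (merge (H (\<delta> b) i b') f))"
            by (simp only: uw[OF t])
          show "t (merge (H (\<delta> b) i b) f) mod N = t (merge (H (\<delta> b) i b') f) mod N"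
            unfolding uw[OF t] by (rule mod_add_cong[OF refl w(1)[OF t]])
        qed
        with det inY have "Q (F (\<delta> b) i, \<rho> i b) (merge (H (\<delta> b) i b) f) =
            Q (F (\<delta> b) i, \<rho> i b) (merge (H (\<delta> b) i b') f)" by (metis imageI)
        then show ?thesis unfolding PQ[OF i] D \<rho> .
      qed
      with distinct b show "b = b'" unfolding e_def by simp
    qed
    define K where "K = n + (nat N + (\<Sum>c\<in>C. nat (snd c)))"
    let ?E = "\<lambda>S. PiE S (\<lambda>_. {..K})"
    have "code ` B \<subseteq> ?E A \<times> ?E C \<times> ?E T \<times> ?E T \<times> ?E T"
    proof (rule image_subsetI)
      fix b
      have "\<delta> b \<in> ?E A"
      proof -
        have "(if \<exists>i. hits b x i then SOME i. hits b x i else n) \<le> n" for x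
        proof (cases "\<exists>i. hits b x i")
          case True
          then have "hits b x (SOME i. hits b x i)" by (rule someI_ex)
          then have "(SOME i. hits b x i) < n" by (simp add: hits_def)
          with True show ?thesis by simp
        qed simp
        then show ?thesis unfolding \<delta>_def by (intro restrict_PiE_iff[THEN iffD2] ballI) (simp add: K_def trans_le_add1)
      qed
      moreover have "restrict (\<lambda>c. nat (\<beta> (fst c) b mod snd c)) C \<in> ?E C"
      proof (intro restrict_PiE_iff[THEN iffD2] ballI)
        fix c assume c: "c \<in> C"
        then have "\<beta> (fst c) b mod snd c < snd c" using AC(4) by simp
        moreover have "nat (snd c) \<le> (\<Sum>c\<in>C. nat (snd c))" using c AC(2) by (intro member_le_sum) auto
        ultimately show "nat (\<beta> (fst c) b mod snd c) \<in> {..K}" by (simp add: K_def)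
      qed
      moreover have "restrict (\<lambda>t. nat (w t b mod N)) T \<in> ?E T"
      proof (intro restrict_PiE_iff[THEN iffD2] ballI)
        fix t
        have "w t b mod N < N" using T(3) by simp
        then show "nat (w t b mod N) \<in> {..K}" by (simp add: K_def)
      qed
      moreover have "restrict (\<lambda>t. card {i \<in> {..<n}. R t i}) T \<in> ?E T" for R
      proof (intro restrict_PiE_iff[THEN iffD2] ballI)
        fix t
        have "card {i \<in> {..<n}. R t i} \<le> card {..<n}" by (intro card_mono) auto
        then show "card {i \<in> {..<n}. R t i} \<in> {..K}" by (simp add: K_def)
      qed
      ultimately show "code b \<in> ?E A \<times> ?E C \<times> ?E T \<times> ?E T \<times> ?E T"
        unfolding code_def by (intro SigmaI)
    qed
    then have "card B \<le> card (?E A \<times> ?E C \<times> ?E T \<times> ?E T \<times> ?E T)"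
      using \<open>inj_on code B\<close> AC T by (intro card_inj_on_le[of code] finite_cartesian_product finite_PiE) auto
    also have "\<dots> = Suc K ^ k"
      using AC T by (simp only: card_cartesian_product card_PiE_atMost k_def power_add)
    also have "Suc K = n + c" by (simp add: K_def c_def)
    finally show "card B \<le> (n + c) ^ k" .
  qed
qed

lemma no_IP_int_pow_struct:
  assumes "d > 0" "wf_fm pow_sig \<phi>"
  shows "\<not> has_IP (int_pow_struct d) \<phi> X"
proof
  assume IP: "has_IP (int_pow_struct d) \<phi> X"
  obtain P where P: "bdef d P" "\<forall>e f. P e f = sat (int_pow_struct d) e \<phi>"
    using bdef_sat[OF assms] by (elim exE conjE)
  obtain c k where ck: "\<forall>n a B. finite B \<longrightarrow>
    (\<forall>b\<in>B. \<forall>b'\<in>B. (\<forall>i<n. P (override_on b (a i) X) (\<lambda>_. 0) = P (override_on b' (a i) X) (\<lambda>_. 0)) \<longrightarrow> b = b') \<longrightarrow>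
    card B \<le> (n + c) ^ k"
    using bdef_few_cuts[OF P(1) assms(1), of X "\<lambda>_. 0"] by (elim exE)
  obtain n where n: "1 * (n + c) ^ k < 2 ^ n" using poly_less_exp[of 1 c k] by auto
  obtain a :: "nat \<Rightarrow> nat \<Rightarrow> int" and b where
    ab: "\<forall>i<n. \<forall>I\<subseteq>{..<n}. sat (int_pow_struct d) (override_on (b I) (a i) X) \<phi> \<longleftrightarrow> i \<in> I"
    using IP[unfolded has_IP_def, THEN spec, of n] by (elim exE)
  have same: "I = J" if IJ: "I \<subseteq> {..<n}" "J \<subseteq> {..<n}"
    and eq: "\<forall>i<n. sat (int_pow_struct d) (override_on (b I) (a i) X) \<phi> =
      sat (int_pow_struct d) (override_on (b J) (a i) X) \<phi>" for I J
  proof -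
    have "i \<in> I \<longleftrightarrow> i \<in> J" if "i < n" for i using ab IJ eq that by simp
    with IJ show ?thesis by auto
  qed
  have "inj_on b (Set.Pow {..<n})" by (intro inj_onI same) auto
  then have "card (b ` Set.Pow {..<n}) = 2 ^ n" by (simp add: card_image card_Pow)
  moreover have "card (b ` Set.Pow {..<n}) \<le> (n + c) ^ k"
  proof (rule ck[rule_format])
    fix x y assume "x \<in> b ` Set.Pow {..<n}" "y \<in> b ` Set.Pow {..<n}" and
      eq: "\<And>i. i < n \<Longrightarrow> P (override_on x (a i) X) (\<lambda>_. 0) = P (override_on y (a i) X) (\<lambda>_. 0)"
    then obtain I J where IJ: "I \<subseteq> {..<n}" "J \<subseteq> {..<n}" "x = b I" "y = b J" by auto
    have "I = J" using IJ(1,2) eq unfolding IJ(3,4) P(2)[rule_format] by (intro same) auto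
    with IJ show "x = y" by simp
  qed simp
  ultimately show False using n by simp
qed

section \<open>Transfer along elementary equivalence\<close>

lemma eval_trm_cong:
  "(\<And>v. v \<in> fv_trm t \<Longrightarrow> e v = e' v) \<Longrightarrow> eval_trm M e t = eval_trm M e' t"
proof (induction t)
  case (App f ts)
  have "map (eval_trm M e) ts = map (eval_trm M e') ts"
    by (intro map_cong refl App.IH App.prems) auto
  then show ?case by (simp only: eval_trm.simps)
qed simp

lemma sat_cong: "(\<And>v. v \<in> fv_fm \<phi> \<Longrightarrow> e v = e' v) \<Longrightarrow> sat M e \<phi> = sat M e' \<phi>"
proof (induction \<phi> arbitrary: e e')
  case (Equal s t)
  have "eval_trm M e s = eval_trm M e' s" "eval_trm M e t = eval_trm M e' t"
    by (rule eval_trm_cong, simp add: Equal)+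
  then show ?case by simp
next
  case (Rel r ts)
  have "map (eval_trm M e) ts = map (eval_trm M e') ts"
    by (intro map_cong refl eval_trm_cong Rel) auto
  then show ?case by (simp only: sat.simps)
next
  case (Neg \<phi>)
  have "sat M e \<phi> = sat M e' \<phi>" using Neg.prems by (intro Neg.IH) simp
  then show ?case by simp
next
  case (Conj \<phi> \<psi>)
  have "sat M e \<phi> = sat M e' \<phi>" using Conj.prems by (intro Conj.IH) simp
  moreover have "sat M e \<psi> = sat M e' \<psi>" using Conj.prems by (intro Conj.IH) simp
  ultimately show ?case by simp
next
  case (Exists v \<phi>)
  have "sat M (e(v := m)) \<phi> = sat M (e'(v := m)) \<phi>" for m
    using Exists.prems by (intro Exists.IH) simp
  then show ?case by simp
qed

lemma finite_fv_fm: "finite (fv_fm \<phi>)"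
proof -
  have "finite (fv_trm t)" for t :: "'f trm" by (induction t) auto
  then show ?thesis by (induction \<phi>) auto
qed

section \<open>Renaming and existential closure\<close>

fun rename_trm :: "(nat \<Rightarrow> nat) \<Rightarrow> 'f trm \<Rightarrow> 'f trm" where
  "rename_trm r (Var v) = Var (r v)"
| "rename_trm r (App f ts) = App f (map (rename_trm r) ts)"

fun rename_fm :: "(nat \<Rightarrow> nat) \<Rightarrow> ('f, 'r) fm \<Rightarrow> ('f, 'r) fm" where
  "rename_fm r (Equal s t) = Equal (rename_trm r s) (rename_trm r t)"
| "rename_fm r (Rel R ts) = Rel R (map (rename_trm r) ts)"
| "rename_fm r (Neg \<phi>) = Neg (rename_fm r \<phi>)"
| "rename_fm r (Conj \<phi> \<psi>) = Conj (rename_fm r \<phi>) (rename_fm r \<psi>)"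
| "rename_fm r (Exists v \<phi>) = Exists (r v) (rename_fm r \<phi>)"

lemma wf_rename_trm: "wf_trm L t \<Longrightarrow> wf_trm L (rename_trm r t)"
  by (induction t) auto

lemma wf_rename_fm: "wf_fm L \<phi> \<Longrightarrow> wf_fm L (rename_fm r \<phi>)"
  by (induction \<phi>) (auto intro: wf_rename_trm)

lemma eval_rename_trm: "eval_trm M e (rename_trm r t) = eval_trm M (\<lambda>v. e (r v)) t"
proof (induction t)
  case (App f ts)
  then have "map (eval_trm M e) (map (rename_trm r) ts) = map (eval_trm M (\<lambda>v. e (r v))) ts" by simp
  then show ?case by (simp only: eval_trm.simps rename_trm.simps)
qed simp

text \<open>Bound variables are renamed too; injectivity of \<open>r\<close> prevents
  capture.\<close>

lemma sat_rename_fm: "inj r \<Longrightarrow> sat M e (rename_fm r \<phi>) = sat M (\<lambda>v. e (r v)) \<phi>"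
proof (induction \<phi> arbitrary: e)
  case (Rel R ts)
  have "map (eval_trm M e) (map (rename_trm r) ts) = map (eval_trm M (\<lambda>v. e (r v))) ts"
    by (simp add: eval_rename_trm)
  then show ?case by (simp only: sat.simps rename_fm.simps)
next
  case (Exists v \<phi>)
  have "(\<lambda>w. (e(r v := m)) (r w)) = (\<lambda>w. e (r w))(v := m)" for m
    using Exists.prems by (auto simp: fun_eq_iff dest: injD)
  then show ?case using Exists by simp
qed (simp_all add: eval_rename_trm)

text \<open>\<open>Equal (Var 0) (Var 0)\<close> stands in for truth; its free variable is later
  bound by \<open>close\<close>.\<close>

fun conjs :: "('f, 'r) fm list \<Rightarrow> ('f, 'r) fm" where
  "conjs [] = Equal (Var 0) (Var 0)"
| "conjs (\<phi> # \<phi>s) = Conj \<phi> (conjs \<phi>s)"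

fun exs :: "nat list \<Rightarrow> ('f, 'r) fm \<Rightarrow> ('f, 'r) fm" where
  "exs [] \<phi> = \<phi>"
| "exs (v # vs) \<phi> = Exists v (exs vs \<phi>)"

lemma wf_conjs: "(\<And>\<phi>. \<phi> \<in> set \<phi>s \<Longrightarrow> wf_fm L \<phi>) \<Longrightarrow> wf_fm L (conjs \<phi>s)"
  by (induction \<phi>s) auto

lemma sat_conjs: "sat M e (conjs \<phi>s) = (\<forall>\<phi>\<in>set \<phi>s. sat M e \<phi>)"
  by (induction \<phi>s) auto

lemma wf_exs: "wf_fm L (exs vs \<phi>) = wf_fm L \<phi>"
  by (induction vs) auto

lemma fv_exs: "fv_fm (exs vs \<phi>) = fv_fm \<phi> - set vs"
  by (induction vs) auto

lemma sat_exsI: "sat M e' \<phi> \<Longrightarrow> (\<And>v. v \<notin> set vs \<Longrightarrow> e' v = e v) \<Longrightarrow> sat M e (exs vs \<phi>)"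
proof (induction vs arbitrary: e)
  case Nil
  then have "e' = e" by auto
  with Nil show ?case by simp
next
  case (Cons v vs)
  have "sat M (e(v := e' v)) (exs vs \<phi>)" using Cons.prems by (intro Cons.IH) auto
  then show ?case by auto
qed

lemma sat_exsD: "sat M e (exs vs \<phi>) \<Longrightarrow> \<exists>e'. sat M e' \<phi>"
  by (induction vs arbitrary: e) auto

text \<open>The closure is existential, because the independence property asks for satisfiability of
  a pattern.\<close>

definition close :: "('f, 'r) fm \<Rightarrow> ('f, 'r) fm" where
  "close \<phi> = exs (sorted_list_of_set (fv_fm \<phi>)) \<phi>"

lemma close_sentence: "wf_fm L \<phi> \<Longrightarrow> close \<phi> \<in> sentences L"
  by (simp add: sentences_def close_def wf_exs fv_exs finite_fv_fm)

lemma sat_close: "sat M e (close \<phi>) = (\<exists>e'. sat M e' \<phi>)"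
proof
  assume "\<exists>e'. sat M e' \<phi>"
  then obtain e' where "sat M e' \<phi>" ..
  then have "sat M (override_on e e' (fv_fm \<phi>)) \<phi>"
    by (subst sat_cong[of \<phi> _ e']) auto
  then show "sat M e (close \<phi>)" unfolding close_def
    by (rule sat_exsI) (simp add: finite_fv_fm)
qed (auto simp: close_def dest: sat_exsD)

text \<open>
  The tuples of an independence pattern are stored in one assignment: the value of \<open>a\<^sub>i\<close> at
  \<open>v\<close> under the index \<open>(2i, v)\<close>, that of \<open>b\<^sub>I\<close> under \<open>(2k + 1, v)\<close>, where \<open>k\<close> encodes \<open>I\<close>.
\<close>

definition pattern_var :: "nat set \<Rightarrow> nat \<Rightarrow> nat set \<Rightarrow> nat \<Rightarrow> nat" where
  "pattern_var X i I v = prod_encode (if v \<in> X then 2 * i else 2 * set_encode I + 1, v)"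

definition pattern_fm :: "('f, 'r) fm \<Rightarrow> nat set \<Rightarrow> nat \<Rightarrow> nat set \<Rightarrow> ('f, 'r) fm" where
  "pattern_fm \<phi> X i I = (if i \<in> I then rename_fm (pattern_var X i I) \<phi>
     else Neg (rename_fm (pattern_var X i I) \<phi>))"

text \<open>The numbers below \<open>2 ^ n\<close> code exactly the subsets of
  \<open>{..<n}\<close>.\<close>

definition shatters_fm :: "('f, 'r) fm \<Rightarrow> nat set \<Rightarrow> nat \<Rightarrow> ('f, 'r) fm" where
  "shatters_fm \<phi> X n = conjs (map (\<lambda>(i, k). pattern_fm \<phi> X i (set_decode k))
     (List.product [0..<n] [0..<2 ^ n]))"

lemma sat_pattern_fm:
  "sat M e (pattern_fm \<phi> X i I) \<longleftrightarrow> (sat M (\<lambda>v. e (pattern_var X i I v)) \<phi> \<longleftrightarrow> i \<in> I)"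
proof -
  have "inj (pattern_var X i I)" by (auto simp: inj_def pattern_var_def)
  then show ?thesis by (auto simp: pattern_fm_def sat_rename_fm)
qed

lemma set_encode_less: "I \<subseteq> {..<n} \<Longrightarrow> set_encode I < 2 ^ n"
proof -
  assume "I \<subseteq> {..<n}"
  then have "set_encode I \<le> set_encode {..<n}" unfolding set_encode_def by (intro sum_mono2) auto
  also have "\<dots> < 2 ^ n" by (simp add: set_encode_def lessThan_atLeast0 sum_power2)
  finally show ?thesis .
qed

lemma sat_shatters_fm:
  "(\<exists>e. sat M e (shatters_fm \<phi> X n)) \<longleftrightarrow> (\<exists>(a :: nat \<Rightarrow> nat \<Rightarrow> 'm) (b :: nat set \<Rightarrow> nat \<Rightarrow> 'm).
     \<forall>i<n. \<forall>I\<subseteq>{..<n}. sat M (override_on (b I) (a i) X) \<phi> \<longleftrightarrow> i \<in> I)"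
proof
  assume "\<exists>e. sat M e (shatters_fm \<phi> X n)"
  then obtain e where e: "sat M e (shatters_fm \<phi> X n)" ..
  define a where "a i v = e (prod_encode (2 * i, v))" for i v
  define b where "b I v = e (prod_encode (2 * set_encode I + 1, v))" for I v
  have "sat M (override_on (b I) (a i) X) \<phi> \<longleftrightarrow> i \<in> I" if "i < n" "I \<subseteq> {..<n}" for i I
  proof -
    have "finite I" using that(2) finite_subset by blast
    then have dec: "set_decode (set_encode I) = I" by simp
    have "sat M e (pattern_fm \<phi> X i (set_decode (set_encode I)))"
      using e that(1) set_encode_less[OF that(2)] unfolding shatters_fm_def sat_conjs by auto
    moreover have "(\<lambda>v. e (pattern_var X i I v)) = override_on (b I) (a i) X"
      by (auto simp: fun_eq_iff pattern_var_def override_on_def a_def b_def)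
    ultimately show ?thesis by (simp add: sat_pattern_fm dec)
  qed
  then show "\<exists>(a :: nat \<Rightarrow> nat \<Rightarrow> 'm) (b :: nat set \<Rightarrow> nat \<Rightarrow> 'm).
     \<forall>i<n. \<forall>I\<subseteq>{..<n}. sat M (override_on (b I) (a i) X) \<phi> \<longleftrightarrow> i \<in> I"
    by (intro exI[of _ a] exI[of _ b]) simp
next
  assume "\<exists>(a :: nat \<Rightarrow> nat \<Rightarrow> 'm) (b :: nat set \<Rightarrow> nat \<Rightarrow> 'm).
     \<forall>i<n. \<forall>I\<subseteq>{..<n}. sat M (override_on (b I) (a i) X) \<phi> \<longleftrightarrow> i \<in> I"
  then obtain a :: "nat \<Rightarrow> nat \<Rightarrow> 'm" and b where
    ab: "\<forall>i<n. \<forall>I\<subseteq>{..<n}. sat M (override_on (b I) (a i) X) \<phi> \<longleftrightarrow> i \<in> I" by (elim exE)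
  define e where "e w = (case prod_decode w of (c, v) \<Rightarrow>
      if even c then a (c div 2) v else b (set_decode (c div 2)) v)" for w
  have "sat M e (pattern_fm \<phi> X i (set_decode k))" if "i < n" "k < 2 ^ n" for i k
  proof -
    have "set_decode k \<subseteq> {..<n}"
    proof
      fix x assume "x \<in> set_decode k"
      then have "2 ^ x \<le> k" by (metis set_decode_def div_less even_zero leI mem_Collect_eq)
      with that(2) have "(2::nat) ^ x < 2 ^ n" by linarith
      then show "x \<in> {..<n}" by simp
    qed
    then have "sat M (override_on (b (set_decode k)) (a i) X) \<phi> \<longleftrightarrow> i \<in> set_decode k"
      using ab that(1) by blast
    moreover have "(\<lambda>v. e (pattern_var X i (set_decode k) v)) = override_on (b (set_decode k)) (a i) X"
      by (auto simp: fun_eq_iff pattern_var_def override_on_def e_def)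
    ultimately show ?thesis by (simp add: sat_pattern_fm)
  qed
  then have "sat M e (shatters_fm \<phi> X n)" unfolding shatters_fm_def sat_conjs by auto
  then show "\<exists>e. sat M e (shatters_fm \<phi> X n)" by (rule exI[of _ e])
qed

lemma has_IP_iff: "has_IP M \<phi> X \<longleftrightarrow> (\<forall>n. \<exists>e. sat M e (shatters_fm \<phi> X n))"
  by (simp only: has_IP_def sat_shatters_fm)

text \<open>For each \<open>n\<close> a single sentence states that an independence pattern of size
  \<open>n\<close> exists. If it failed in \<open>N\<close>, its negation would belong to the
  complete theory and hold in \<open>M\<close>.\<close>

lemma has_IP_transfer:
  assumes "models M (complete_theory L N)" "wf_fm L \<phi>" "has_IP M \<phi> X"
  shows "has_IP N \<phi> X"
  unfolding has_IP_iff
proof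
  fix n
  have wf: "wf_fm L (shatters_fm \<phi> X n)" unfolding shatters_fm_def
    using assms(2) by (intro wf_conjs) (auto simp: pattern_fm_def wf_rename_fm)
  show "\<exists>e. sat N e (shatters_fm \<phi> X n)"
  proof (rule ccontr)
    assume "\<nexists>e. sat N e (shatters_fm \<phi> X n)"
    then have "\<forall>e. sat N e (Neg (close (shatters_fm \<phi> X n)))" by (simp add: sat_close)
    moreover have "Neg (close (shatters_fm \<phi> X n)) \<in> sentences L"
      using close_sentence[OF wf] by (simp add: sentences_def)
    ultimately have "Neg (close (shatters_fm \<phi> X n)) \<in> complete_theory L N"
      by (simp add: complete_theory_def)
    then have "\<forall>e. sat M e (Neg (close (shatters_fm \<phi> X n)))"
      using assms(1) unfolding models_def by (rule bspec[rotated])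
    then have "\<forall>e. \<not> sat M e (shatters_fm \<phi> X n)" by (simp add: sat_close)
    moreover obtain e where "sat M e (shatters_fm \<phi> X n)"
      using assms(3) has_IP_iff by metis
    ultimately show False by simp
  qed
qed

theorem theorem6p9:
  fixes d :: nat
  assumes "d > 0"
  shows "NIP TYPE('m) pow_sig (complete_theory pow_sig (int_pow_struct d))"
  unfolding NIP_def
  using has_IP_transfer no_IP_int_pow_struct[OF assms] by metis

end
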